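(* Let $(L,(\cdot,\cdot),\Phi)$ be an extended affine root lattice of rank $n$ with a radical $\operatorname{Rad}(L)$ of rank $r\ge1$. Let $w\in W$ be a quasi Coxeter element, and let $\overline{w}$ be the induced element in the Weyl group $W(L/\operatorname{Rad}(L))$ of the quotient p.n. root lattice. Then $$l(\overline{w})\le n-r\qquad\text{and}\qquad l(\overline{w})+2k_5(L/\operatorname{Rad}(L),\overline{w})\le n.$$
   Context: An extended affine root lattice is a triple $(L,(\cdot,\cdot),\Phi)$ where $L$ is a free $\mathbb{Z}$-module of finite rank, $(\cdot,\cdot):L_{\mathbb{Q}}\times L_{\mathbb{Q}}\to\mathbb{Q}$ is a symmetric positive semidefinite bilinear form, and $\Phi\subset L\setminus\{\alpha\in L\mid(\alpha,\alpha)=0\}$ is a subset (the roots) such that: $\Phi$ generates $L$ as a $\mathbb{Z}$-module; $s_\alpha(\Phi)=\Phi$ for all $\alpha\in\Phi$; $\langle\beta,\alpha\rangle\in\mathbb{Z}$ for all $\alpha,\beta\in\Phi$. Here $\langle\beta,\alpha\rangle=2(\beta,\alpha)/(\alpha,\alpha)$ and $s_\alpha(x)=x-\langle x,\alpha\rangle\alpha$. Its Weyl group is $W=W(L)=\langle s_\alpha\mid\alpha\in\Phi\rangle$. The radical is $\operatorname{Rad}(L)=\{\alpha\in L\mid(\alpha,\beta)=0\ \forall\beta\in L\}$. The quotient $L/\operatorname{Rad}(L)$ with the induced form and the set of roots $\Phi_{quot}=(\Phi+\operatorname{Rad}(L))/\operatorname{Rad}(L)$ is a p.n. root lattice, i.e.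 the induced form is positive definite, $\Phi_{quot}$ is finite, does not contain $0$, generates the lattice, is mapped to itself by all $s_\alpha$, $\alpha\in\Phi_{quot}$, and $\langle\beta,\alpha\rangle\in\mathbb{Z}$ for $\alpha,\beta\in\Phi_{quot}$. Its Weyl group $W(L/\operatorname{Rad}(L))$ is generated by its reflections; each $w\in W(L)$ induces $\overline{w}\in W(L/\operatorname{Rad}(L))$. In both settings: a presentation of a Weyl group element $w$ is a tuple $(\alpha_1,\dots,\alpha_k)$ of roots with $w=s_{\alpha_1}\circ\cdots\circ s_{\alpha_k}$; $k$ is its length; its subroot lattice is $\sum_i\mathbb{Z}\alpha_i$; the length $l(w)$ is the minimum of the lengths of all presentations of $w$. An element $w\in W(L)$ of the Weyl group of the extended affine root lattice of rank $n$ is a quasi Coxeter element if it has a presentation of length $n$ whose subroot lattice is the full lattice $L$. For an element $v$ of the Weyl group of a p.n. root lattice $M$, $k_5(M,v):=\min\{k\mid\text{a presentation }(\alpha_1,\dots,\alpha_{l(v)+2k})\text{ of }v\text{ whose subroot lattice is the full lattice }M\text{ exists}\}$. *)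

theory Defs
  imports "HOL-Algebra.Bij" "HOL-Algebra.Free_Abelian_Groups"
begin

text \<open>
  A lattice is a free abelian group of finite rank. It is written multiplicatively, as is usual for
  groups in HOL-Algebra: \<open>x \<otimes> y\<close> is the sum of two lattice elements and \<open>x [^] k\<close> the
  \<open>k\<close>-fold multiple of \<open>x\<close>. Having a carrier, \<open>L\<close> and the quotient \<open>L Mod radical L B\<close> are
  objects of the same kind, so that everything up to \<open>k5\<close> applies to both. The roots are a set
  \<open>R\<close>, and the form \<open>B\<close> is given by its values on \<open>L\<close>; a biadditive map
  \<open>L \<times> L \<rightarrow> \<rat>\<close> is the restriction of exactly one \<open>\<rat>\<close>-bilinear form on
  \<open>\<rat> \<otimes> L\<close>, and one of them is symmetric (positive semidefinite) iff the other is.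
\<close>

definition pairing :: "('a \<Rightarrow> 'a \<Rightarrow> rat) \<Rightarrow> 'a \<Rightarrow> 'a \<Rightarrow> rat" where
  "pairing B x a = 2 * B x a / B a a"

text \<open>
  The rational number \<open>pairing B x a\<close> is an integer for all \<open>x\<close> in the lattice if \<open>a\<close> is a root
  (see \<open>pairing_Ints\<close> below for \<open>L\<close>), so the floor only converts the type.
  As in \<^const>\<open>BijGroup\<close>, maps on the lattice are extensional.
\<close>

definition reflection ::
    "('a, 'b) monoid_scheme \<Rightarrow> ('a \<Rightarrow> 'a \<Rightarrow> rat) \<Rightarrow> 'a \<Rightarrow> 'a \<Rightarrow> 'a" where
  "reflection L B a =
     (\<lambda>x\<in>carrier L. x \<otimes>\<^bsub>L\<^esub> inv\<^bsub>L\<^esub> (a [^]\<^bsub>L\<^esub> \<lfloor>pairing B x a\<rfloor>))"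

definition weyl_group ::
    "('a, 'b) monoid_scheme \<Rightarrow> ('a \<Rightarrow> 'a \<Rightarrow> rat) \<Rightarrow> 'a set \<Rightarrow> ('a \<Rightarrow> 'a) set" where
  "weyl_group L B R = generate (BijGroup (carrier L)) (reflection L B ` R)"

definition is_presentation ::
    "('a, 'b) monoid_scheme \<Rightarrow> ('a \<Rightarrow> 'a \<Rightarrow> rat) \<Rightarrow> 'a set \<Rightarrow> ('a \<Rightarrow> 'a) \<Rightarrow> 'a list \<Rightarrow> bool" where
  "is_presentation L B R w as \<longleftrightarrow>
     set as \<subseteq> R \<and>
     w = foldr (compose (carrier L)) (map (reflection L B) as) (\<lambda>x\<in>carrier L. x)"

definition subroot_lattice :: "('a, 'b) monoid_scheme \<Rightarrow> 'a list \<Rightarrow> 'a set" where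
  "subroot_lattice L as = generate L (set as)"

definition weyl_length ::
    "('a, 'b) monoid_scheme \<Rightarrow> ('a \<Rightarrow> 'a \<Rightarrow> rat) \<Rightarrow> 'a set \<Rightarrow> ('a \<Rightarrow> 'a) \<Rightarrow> nat" where
  "weyl_length L B R w = (LEAST k. \<exists>as. is_presentation L B R w as \<and> length as = k)"

text \<open>
  For an element of the Weyl group of a root lattice \<open>M\<close> with finitely many roots, the minimum is
  over a nonempty set, since one may append \<open>a, a\<close> to a presentation for every root \<open>a\<close>.
\<close>

definition k5 ::
    "('a, 'b) monoid_scheme \<Rightarrow> ('a \<Rightarrow> 'a \<Rightarrow> rat) \<Rightarrow> 'a set \<Rightarrow> ('a \<Rightarrow> 'a) \<Rightarrow> nat" where
  "k5 M B R v =
     (LEAST k. \<exists>as. is_presentation M B R v as \<and> length as = weyl_length M B R v + 2 * k \<and>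
                    subroot_lattice M as = carrier M)"

definition radical :: "('a, 'b) monoid_scheme \<Rightarrow> ('a \<Rightarrow> 'a \<Rightarrow> rat) \<Rightarrow> 'a set" where
  "radical L B = {x \<in> carrier L. \<forall>y\<in>carrier L. B x y = 0}"

definition has_rank :: "('a, 'b) monoid_scheme \<Rightarrow> nat \<Rightarrow> bool" where
  "has_rank L n \<longleftrightarrow> L \<cong> free_Abelian_group {..<n}"

locale extended_affine_root_lattice = comm_group L for L (structure) +
  fixes n :: nat
    and B :: "'a \<Rightarrow> 'a \<Rightarrow> rat"
    and R :: "'a set"
  assumes free: "has_rank L n"
    and form_add_left:
      "\<lbrakk>x \<in> carrier L; y \<in> carrier L; z \<in> carrier L\<rbrakk> \<Longrightarrow> B (x \<otimes> y) z = B x z + B y z"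
    and form_sym: "\<lbrakk>x \<in> carrier L; y \<in> carrier L\<rbrakk> \<Longrightarrow> B x y = B y x"
    and form_nonneg: "x \<in> carrier L \<Longrightarrow> 0 \<le> B x x"
    and roots_subset: "R \<subseteq> carrier L - {x \<in> carrier L. B x x = 0}"
    and roots_generate: "generate L R = carrier L"
    and roots_reflection: "a \<in> R \<Longrightarrow> reflection L B a ` R = R"
    and roots_integral: "\<lbrakk>a \<in> R; b \<in> R\<rbrakk> \<Longrightarrow> pairing B b a \<in> \<int>"

definition quasi_coxeter ::
    "('a, 'b) monoid_scheme \<Rightarrow> nat \<Rightarrow> ('a \<Rightarrow> 'a \<Rightarrow> rat) \<Rightarrow> 'a set \<Rightarrow> ('a \<Rightarrow> 'a) \<Rightarrow> bool" where
  "quasi_coxeter L n B R w \<longleftrightarrow>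
     w \<in> weyl_group L B R \<and>
     (\<exists>as. is_presentation L B R w as \<and> length as = n \<and> subroot_lattice L as = carrier L)"

text \<open>
  The elements of the quotient \<open>L Mod radical L B\<close> are cosets. Its form takes a pair of cosets to
  the common value of \<open>B\<close> on their members, and its roots are the cosets of the roots. The induced
  map sends a coset to its image under \<open>w\<close>, which is again a coset if \<open>w\<close> is in the Weyl group.
\<close>

definition quot_form :: "('a \<Rightarrow> 'a \<Rightarrow> rat) \<Rightarrow> 'a set \<Rightarrow> 'a set \<Rightarrow> rat" where
  "quot_form B X Y = the_elem {B x y | x y. x \<in> X \<and> y \<in> Y}"

definition quot_roots ::
    "('a, 'b) monoid_scheme \<Rightarrow> ('a \<Rightarrow> 'a \<Rightarrow> rat) \<Rightarrow> 'a set \<Rightarrow> 'a set set" where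
  "quot_roots L B R = (\<lambda>a. radical L B #>\<^bsub>L\<^esub> a) ` R"

definition induced_map ::
    "('a, 'b) monoid_scheme \<Rightarrow> ('a \<Rightarrow> 'a \<Rightarrow> rat) \<Rightarrow> ('a \<Rightarrow> 'a) \<Rightarrow> 'a set \<Rightarrow> 'a set" where
  "induced_map L B w = (\<lambda>X\<in>carrier (L Mod radical L B). w ` X)"


context extended_affine_root_lattice
begin

lemma form_one: "x \<in> carrier L \<Longrightarrow> B \<one> x = 0"
  using form_add_left[of \<one> \<one> x] by simp

lemma form_inv: "\<lbrakk>x \<in> carrier L; y \<in> carrier L\<rbrakk> \<Longrightarrow> B (inv x) y = - B x y"
  using form_add_left[of x "inv x" y] form_one[of y] by simp

lemma pairing_Ints:
  assumes a: "a \<in> R" and x: "x \<in> carrier L"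
  shows "pairing B x a \<in> \<int>"
proof -
  have aL: "a \<in> carrier L" and RL: "R \<subseteq> carrier L" using a roots_subset by auto
  have "x \<in> generate L R" using x roots_generate by simp
  then show ?thesis
  proof induction
    case one
    then show ?case using form_one[OF aL] by (simp add: pairing_def)
  next
    case (incl h)
    then show ?case using roots_integral a by blast
  next
    case (inv h)
    then have "pairing B (inv h) a = - pairing B h a"
      using form_inv[of h a] aL RL by (auto simp: pairing_def)
    then show ?case using roots_integral[OF a inv] by simp
  next
    case (eng h1 h2)
    then have "h1 \<in> carrier L" "h2 \<in> carrier L"
      using roots_generate by auto
    then have "pairing B (h1 \<otimes> h2) a = pairing B h1 a + pairing B h2 a"
      using form_add_left aL by (simp add: pairing_def add_divide_distrib distrib_left)
    then show ?case using eng by simp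
  qed
qed

lemma quot_form_rcoset:
  assumes x: "x \<in> carrier L" and y: "y \<in> carrier L"
  shows "quot_form B (radical L B #> x) (radical L B #> y) = B x y"
proof -
  have *: "B (s \<otimes> x) (t \<otimes> y) = B x y" if "s \<in> radical L B" "t \<in> radical L B" for s t
  proof -
    have s: "s \<in> carrier L" "\<And>z. z \<in> carrier L \<Longrightarrow> B s z = 0"
      and t: "t \<in> carrier L" "\<And>z. z \<in> carrier L \<Longrightarrow> B t z = 0"
      using that by (auto simp: radical_def)
    have "B (s \<otimes> x) (t \<otimes> y) = B x (t \<otimes> y)"
      using s t x y by (simp add: form_add_left)
    also have "\<dots> = B (t \<otimes> y) x" using x y t by (simp add: form_sym)
    also have "\<dots> = B y x" using t x y by (simp add: form_add_left)
    finally show ?thesis using x y by (simp add: form_sym)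
  qed
  have one: "\<one> \<in> radical L B" using form_one by (simp add: radical_def)
  have "{B u v | u v. u \<in> radical L B #> x \<and> v \<in> radical L B #> y} = {B x y}" (is "?S = _")
  proof
    show "?S \<subseteq> {B x y}" by (auto simp: r_coset_def *)
    have "x \<in> radical L B #> x" "y \<in> radical L B #> y"
      using one x y unfolding r_coset_def by (metis (no_types, lifting) UN_I l_one singletonI)+
    then show "{B x y} \<subseteq> ?S" by blast
  qed
  then show ?thesis by (simp add: quot_form_def)
qed

end

end

theory Submission
  imports Defs HOL.Vector_Spaces "HOL-Library.Function_Algebras"
begin

text \<open>
  Write \<open>M\<close> for \<open>L\<close> modulo its radical and \<open>v\<close> for the map that \<open>w\<close> induces on \<open>M\<close>. Reducing a
  presentation of \<open>w\<close> by \<open>n\<close> roots that generate \<open>L\<close> gives a presentation of \<open>v\<close> by \<open>n\<close> roots that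
  generate \<open>M\<close>. The theorem says how far the length of \<open>v\<close> lies below \<open>n\<close>, and it follows from two
  facts about the Weyl group of a root lattice with positive definite form and finitely many roots.

  Parity (\<open>presentation_parity\<close>): any two presentations of one element have lengths of the same
  parity. So \<open>n = l(v) + 2 k\<close> for some \<open>k\<close>, and the reduced presentation witnesses that the
  minimum \<open>k\<^sub>5\<close> is at most \<open>k\<close>.

  Length (\<open>short_presentation\<close>): every element is a product of at most as many reflections as there
  are linearly independent roots. Independent roots of \<open>M\<close>, lifted to \<open>L\<close>, and a basis of the
  radical are together independent over \<open>\<int>\<close>, and a free abelian group of rank \<open>n\<close> has no more
  than \<open>n\<close> independent elements; hence \<open>l(v) \<le> n - r\<close>.

  Both facts come from one statement about finite reflection groups, \<open>regular_stabilizer\<close>: if a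
  product of reflections fixes a regular vector, that is, one orthogonal to no root, it is the
  identity, and the number of its factors is even. To prove it, the factors are replaced by
  reflections in simple roots (an odd number for each), and the word is shortened by two letters at
  a time with the deletion argument. Parity follows at once. For the length, let \<open>u \<noteq> 1\<close> be a
  product of reflections. The space fixed by \<open>u\<close> contains no regular vector, so some root \<open>a\<close> is
  orthogonal to it; then \<open>s\<^sub>a u\<close> fixes everything that \<open>u\<close> fixes and one further vector orthogonal
  to it. After at most as many steps as the dimension of the span of the roots the identity is
  reached.

  These arguments are linear algebra, so they are carried out in a rational vector space, into which
  \<open>M\<close> is embedded by sending \<open>x\<close> to the function \<open>y \<mapsto> B x y\<close> on the roots.
\<close>

section \<open>Finite root systems in a rational vector space\<close>

text \<open>
  The form is required to be definite on the span of the roots only: the space to which this is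
  applied consists of functions, and its form vanishes on those that are zero at all roots.
\<close>

locale root_system = vector_space scale
  for scale :: "rat \<Rightarrow> 'v::ab_group_add \<Rightarrow> 'v" (infixr \<open>*s\<close> 75) +
  fixes form :: "'v \<Rightarrow> 'v \<Rightarrow> rat" (infix \<open>\<cdot>\<close> 70)
    and Phi :: "'v set"
  assumes form_add: "(x + y) \<cdot> z = x \<cdot> z + y \<cdot> z"
    and form_scale: "(c *s x) \<cdot> y = c * (x \<cdot> y)"
    and form_commute: "x \<cdot> y = y \<cdot> x"
    and form_pos: "\<lbrakk>x \<in> span Phi; x \<noteq> 0\<rbrakk> \<Longrightarrow> 0 < x \<cdot> x"
    and finite_Phi: "finite Phi"
    and zero_notin_Phi: "0 \<notin> Phi"
    and Phi_reflected:
      "\<lbrakk>a \<in> Phi; b \<in> Phi\<rbrakk> \<Longrightarrow> b - (2 * (b \<cdot> a) / (a \<cdot> a)) *s a \<in> Phi"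
begin

definition coef :: "'v \<Rightarrow> 'v \<Rightarrow> rat" where
  "coef x a = 2 * (x \<cdot> a) / (a \<cdot> a)"

definition reflect :: "'v \<Rightarrow> 'v \<Rightarrow> 'v" where
  "reflect a x = x - coef x a *s a"

definition word :: "'v list \<Rightarrow> 'v \<Rightarrow> 'v" where
  "word as = foldr (\<lambda>a g. reflect a \<circ> g) as id"

lemma word_Nil [simp]: "word [] = id"
  and word_Cons [simp]: "word (a # as) = reflect a \<circ> word as"
  by (simp_all add: word_def)

lemma word_append [simp]: "word (as @ bs) = word as \<circ> word bs"
  by (induction as) (auto simp: comp_assoc)

lemma form_add_right: "z \<cdot> (x + y) = z \<cdot> x + z \<cdot> y"
  by (metis form_add form_commute)

lemma form_scale_right: "y \<cdot> (c *s x) = c * (y \<cdot> x)"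
  by (metis form_scale form_commute)

lemma form_zero [simp]: "0 \<cdot> x = 0" "x \<cdot> 0 = 0"
  using form_scale[of 0 0 x] form_scale_right[of x 0 0] by auto

lemma form_minus: "(- x) \<cdot> y = - (x \<cdot> y)" "y \<cdot> (- x) = - (y \<cdot> x)"
  using form_scale[of "-1" x y] form_scale_right[of y "-1" x] by auto

lemma form_diff: "(x - y) \<cdot> z = x \<cdot> z - y \<cdot> z" "z \<cdot> (x - y) = z \<cdot> x - z \<cdot> y"
  using form_add[of x "- y" z] form_add_right[of z x "- y"] by (auto simp: form_minus)

lemma form_sum: "(\<Sum>i\<in>I. g i) \<cdot> z = (\<Sum>i\<in>I. g i \<cdot> z)" "z \<cdot> (\<Sum>i\<in>I. g i) = (\<Sum>i\<in>I. z \<cdot> g i)"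
  by (induction I rule: infinite_finite_induct) (auto simp: form_add form_add_right)

lemmas form_simps = form_add form_add_right form_scale form_scale_right form_minus form_diff form_sum

lemma form_root_pos: "a \<in> Phi \<Longrightarrow> 0 < a \<cdot> a"
  using form_pos[of a] zero_notin_Phi by (metis span_base)

lemma reflect_in_Phi: "\<lbrakk>a \<in> Phi; b \<in> Phi\<rbrakk> \<Longrightarrow> reflect a b \<in> Phi"
  using Phi_reflected by (simp add: reflect_def coef_def)

lemma reflect_self: "a \<in> Phi \<Longrightarrow> reflect a a = - a"
  using form_root_pos[of a] scale_left_diff_distrib[of 1 2 a]
  by (simp add: reflect_def coef_def)

lemma uminus_in_Phi: "a \<in> Phi \<Longrightarrow> - a \<in> Phi"
  using reflect_in_Phi[of a a] reflect_self by simp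

lemma reflect_add: "reflect a (x + y) = reflect a x + reflect a y"
  by (simp add: reflect_def coef_def form_simps add_divide_distrib distrib_left scale_left_distrib)

lemma reflect_scale: "reflect a (c *s x) = c *s reflect a x"
  by (simp add: reflect_def coef_def form_simps scale_right_diff_distrib algebra_simps)

lemma coef_reflect: "a \<in> Phi \<Longrightarrow> coef (reflect a x) a = - coef x a"
  using form_root_pos[of a] by (simp add: reflect_def coef_def form_simps field_simps)

lemma reflect_involution [simp]: "a \<in> Phi \<Longrightarrow> reflect a (reflect a x) = x"
  using coef_reflect[of a x] by (simp add: reflect_def)

lemma form_reflect: assumes "a \<in> Phi" shows "reflect a x \<cdot> reflect a y = x \<cdot> y"
proof -
  have *: "x \<cdot> a = coef x a * (a \<cdot> a) / 2" "y \<cdot> a = coef y a * (a \<cdot> a) / 2"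
    using form_root_pos[OF assms] by (simp_all add: coef_def)
  then show ?thesis
    by (simp add: reflect_def form_simps form_commute[of a y] * algebra_simps)
qed

lemma reflect_scaled_root: "c \<noteq> 0 \<Longrightarrow> reflect (c *s a) = reflect a"
  by (auto simp: reflect_def coef_def form_simps fun_eq_iff)

lemma reflect_uminus_root: "reflect (- a) = reflect a"
  using reflect_scaled_root[of "-1" a] by simp

lemma word_linear:
  "word as (x + y) = word as x + word as y" "word as (c *s x) = c *s word as x"
  by (induction as) (simp_all add: reflect_add reflect_scale)

lemma word_zero [simp]: "word as 0 = 0"
  using word_linear(2)[of as 0 0] by simp

lemma word_minus: "word as (- x) = - word as x"
  using word_linear(2)[of as "-1" x] by simp

lemma word_sum: "word as (\<Sum>i\<in>I. g i) = (\<Sum>i\<in>I. word as (g i))"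
  by (induction I rule: infinite_finite_induct) (auto simp: word_linear)

lemma form_word: "set as \<subseteq> Phi \<Longrightarrow> word as x \<cdot> word as y = x \<cdot> y"
  by (induction as) (simp_all add: form_reflect)

lemma word_in_Phi: "\<lbrakk>set as \<subseteq> Phi; b \<in> Phi\<rbrakk> \<Longrightarrow> word as b \<in> Phi"
  by (induction as) (simp_all add: reflect_in_Phi)

lemma word_rev: "set as \<subseteq> Phi \<Longrightarrow> word (rev as) (word as x) = x"
  by (induction as arbitrary: x) simp_all

lemma word_in_span: assumes as: "set as \<subseteq> Phi" and x: "x \<in> span Phi" shows "word as x \<in> span Phi"
  using x
proof (induction rule: span_induct_alt)
  case base
  then show ?case by (simp add: span_zero)
next
  case (step c x y)
  then show ?case using word_in_Phi[OF as]
    by (simp add: word_linear span_add span_scale span_base)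
qed

lemma word_conj_reflect:
  assumes "set as \<subseteq> Phi"
  shows "word as (reflect b x) = reflect (word as b) (word as x)"
  using assms by (simp add: reflect_def coef_def form_word word_linear word_minus
      diff_conv_add_uminus del: add_uminus_conv_diff)

section \<open>Positive and simple roots\<close>

definition pos :: "'v \<Rightarrow> 'v \<Rightarrow> bool" where
  "pos f a \<longleftrightarrow> a \<in> Phi \<and> 0 < a \<cdot> f"

text \<open>
  The simple roots are characterized by what the deletion argument uses: their reflections make no
  positive root negative except the multiples of the root itself. Thus no base of the root system
  has to be constructed; what remains to be shown is that there are enough simple roots.
\<close>

definition simple :: "'v \<Rightarrow> 'v \<Rightarrow> bool" where
  "simple f a \<longleftrightarrow> pos f a \<and> (\<forall>b. pos f b \<and> b \<notin> range (\<lambda>c. c *s a) \<longrightarrow> pos f (reflect a b))"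

definition regular :: "'v \<Rightarrow> bool" where
  "regular f \<longleftrightarrow> (\<forall>a\<in>Phi. a \<cdot> f \<noteq> 0)"

lemma pos_cases: "\<lbrakk>regular f; a \<in> Phi\<rbrakk> \<Longrightarrow> pos f a \<or> pos f (- a)"
  unfolding pos_def regular_def using uminus_in_Phi by (force simp: form_minus)

text \<open>
  The component of \<open>c\<close> orthogonal to \<open>a\<close> is not zero, so its square length is positive.
\<close>

lemma strict_Cauchy_Schwarz:
  assumes a: "a \<in> Phi" and c: "c \<in> Phi" and nl: "c \<notin> range (\<lambda>t. t *s a)"
  shows "(coef c a)\<^sup>2 * (a \<cdot> a) < 4 * (c \<cdot> c)"
proof -
  define t where "t = coef c a / 2"
  have ca: "c \<cdot> a = t * (a \<cdot> a)" "a \<cdot> c = t * (a \<cdot> a)"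
    using form_root_pos[OF a] by (simp_all add: t_def coef_def form_commute[of a c])
  have "c - t *s a \<noteq> 0" using nl by auto
  moreover have "c - t *s a \<in> span Phi"
    using a c by (simp add: span_diff span_scale span_base)
  ultimately have "0 < (c - t *s a) \<cdot> (c - t *s a)" by (rule form_pos[rotated])
  also have "\<dots> = c \<cdot> c - t\<^sup>2 * (a \<cdot> a)"
    by (simp add: form_simps ca power2_eq_square algebra_simps)
  finally show ?thesis by (simp add: t_def power_divide)
qed

text \<open>
  Let \<open>q\<close> be the least ratio of \<open>a \<cdot> f\<close> to \<open>g \<cdot> a\<close> among the positive roots with \<open>0 < g \<cdot> a\<close>. The
  linear functional \<open>k\<close> that sends \<open>x\<close> to \<open>x \<cdot> f - q * (g \<cdot> x)\<close> is then nonnegative on all positive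
  roots. Among the positive roots at which it vanishes, choose \<open>a\<close> such that \<open>a / |a|\<close> has the
  least height \<open>a \<cdot> f / |a|\<close>. If \<open>s\<^sub>a\<close> sent a positive root \<open>c\<close> not parallel to \<open>a\<close> to a negative one \<open>- d\<close>, a
  multiple of \<open>a\<close> would be the sum of \<open>c\<close> and \<open>d\<close>; hence \<open>k\<close> vanishes at both, and as \<open>|c| = |d|\<close>,
  strict Cauchy-Schwarz shows that one of them has smaller normalized height.
\<close>

lemma exists_simple:
  assumes f: "regular f" and g: "pos f g"
  shows "\<exists>a. simple f a \<and> 0 < g \<cdot> a"
proof -
  define E where "E = {a. pos f a \<and> 0 < g \<cdot> a}"
  have finE: "finite E" by (rule finite_subset[OF _ finite_Phi]) (auto simp: E_def pos_def)
  have gE: "g \<in> E" using g form_root_pos by (auto simp: E_def pos_def)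
  define q where "q = Min ((\<lambda>a. a \<cdot> f / (g \<cdot> a)) ` E)"
  define k where "k x = x \<cdot> f - q * (g \<cdot> x)" for x
  have q_in: "q \<in> (\<lambda>a. a \<cdot> f / (g \<cdot> a)) ` E"
    unfolding q_def using finE gE by (intro Min_in) auto
  have q_pos: "0 < q" using q_in by (auto simp: E_def pos_def)
  have k_nonneg: "0 \<le> k e" if "pos f e" for e
  proof (cases "0 < g \<cdot> e")
    case True
    then have "q \<le> e \<cdot> f / (g \<cdot> e)" unfolding q_def using finE that by (intro Min_le) (auto simp: E_def)
    then show ?thesis using True by (simp add: k_def field_simps)
  next
    case False
    then have "q * (g \<cdot> e) \<le> 0" using q_pos by (simp add: mult_nonneg_nonpos)
    then show ?thesis using that by (simp add: k_def pos_def)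
  qed
  define K where "K = {a. pos f a \<and> k a = 0}"
  have finK: "finite K" by (rule finite_subset[OF _ finite_Phi]) (auto simp: K_def pos_def)
  have neK: "K \<noteq> {}" using q_in by (auto simp: K_def k_def E_def)
  \<comment> \<open>the square of the normalized height, which is rational\<close>
  define m where "m a = (a \<cdot> f)\<^sup>2 / (a \<cdot> a)" for a
  obtain a where aK: "a \<in> K" and a_min: "\<And>e. e \<in> K \<Longrightarrow> m a \<le> m e"
    using ex_is_arg_min_if_finite[OF finK neK, of m] by (auto simp: is_arg_min_linorder)
  have a: "pos f a" "a \<in> Phi" "0 < a \<cdot> f" "k a = 0" using aK by (auto simp: K_def pos_def)
  have "pos f (reflect a c)" if c: "pos f c" and nl: "c \<notin> range (\<lambda>t. t *s a)" for c
  proof (rule ccontr)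
    assume neg: "\<not> pos f (reflect a c)"
    define d where "d = - reflect a c"
    have cP: "c \<in> Phi" using c by (simp add: pos_def)
    have d: "pos f d" using pos_cases[OF f reflect_in_Phi[OF a(2) cP]] neg by (simp add: d_def)
    have cd: "c + d = coef c a *s a" by (simp add: d_def reflect_def)
    have "k c + k d = k (c + d)" by (simp add: k_def form_simps algebra_simps)
    also have "\<dots> = coef c a * k a" by (simp add: cd k_def form_simps algebra_simps)
    finally have "k c = 0" "k d = 0" using k_nonneg[OF c] k_nonneg[OF d] a(4) by auto
    then have K: "c \<in> K" "d \<in> K" using c d by (auto simp: K_def)
    have hsum: "c \<cdot> f + d \<cdot> f = coef c a * (a \<cdot> f)"
      by (metis cd form_add form_scale)
    have dd: "d \<cdot> d = c \<cdot> c" by (simp add: d_def form_minus form_reflect a(2))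
    obtain u where u: "u \<in> K" "0 < u \<cdot> f" "2 * (u \<cdot> f) \<le> coef c a * (a \<cdot> f)" "u \<cdot> u = c \<cdot> c"
    proof (cases "c \<cdot> f \<le> d \<cdot> f")
      case True
      then show ?thesis using that[of c] K hsum c by (auto simp: pos_def)
    next
      case False
      then show ?thesis using that[of d] K hsum d dd by (auto simp: pos_def)
    qed
    have ccp: "0 < c \<cdot> c" "0 < a \<cdot> a" using form_root_pos cP a(2) by auto
    have "(2 * (u \<cdot> f))\<^sup>2 \<le> (coef c a * (a \<cdot> f))\<^sup>2"
      using u by (intro power_mono) auto
    then have "4 * (u \<cdot> f)\<^sup>2 * (a \<cdot> a) \<le> ((coef c a)\<^sup>2 * (a \<cdot> a)) * (a \<cdot> f)\<^sup>2"
      using ccp by (simp add: power_mult_distrib mult.commute mult.left_commute)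
    also have "\<dots> < (4 * (c \<cdot> c)) * (a \<cdot> f)\<^sup>2"
      using strict_Cauchy_Schwarz[OF a(2) cP nl] a(3) by (intro mult_strict_right_mono) auto
    finally have "m u < m a" using ccp by (simp add: m_def u(4) field_simps)
    then show False using a_min[OF u(1)] by simp
  qed
  then have "simple f a" using a(1) by (auto simp: simple_def)
  moreover have "0 < g \<cdot> a"
  proof -
    have "q * (g \<cdot> a) > 0" using a by (simp add: k_def)
    then show ?thesis using q_pos by (simp add: zero_less_mult_iff)
  qed
  ultimately show ?thesis by blast
qed

lemma simple_in_Phi: "simple f a \<Longrightarrow> a \<in> Phi"
  by (simp add: simple_def pos_def)

text \<open>
  A simple root \<open>a\<close> with \<open>0 < b \<cdot> a\<close> lowers \<open>b\<close> to \<open>s\<^sub>a b\<close>, and the reflection in \<open>b\<close> is the conjugate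
  by \<open>s\<^sub>a\<close> of the one in \<open>s\<^sub>a b\<close>. So by induction on the number of lower positive roots the
  reflection in \<open>b\<close> is a palindrome of simple reflections, which has odd length.
\<close>

lemma reflect_eq_simple_word_pos:
  assumes f: "regular f"
  shows "pos f b \<Longrightarrow> \<exists>as. (\<forall>a\<in>set as. simple f a) \<and> odd (length as) \<and> word as = reflect b"
proof (induction "card {c. pos f c \<and> c \<cdot> f < b \<cdot> f}" arbitrary: b rule: less_induct)
  case less
  have bP: "b \<in> Phi" using less.prems by (simp add: pos_def)
  obtain a where a: "simple f a" "0 < b \<cdot> a" using exists_simple[OF f less.prems] by blast
  have aP: "a \<in> Phi" using a(1) by (rule simple_in_Phi)
  show ?case
  proof (cases "b \<in> range (\<lambda>c. c *s a)")
    case True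
    then obtain c where c: "b = c *s a" by auto
    then have "c \<noteq> 0" using bP zero_notin_Phi by auto
    then have "word [a] = reflect b" using reflect_scaled_root c by simp
    then show ?thesis using a(1) by (intro exI[of _ "[a]"]) simp
  next
    case False
    define b' where "b' = reflect a b"
    have b': "pos f b'" using a(1) False less.prems by (auto simp: simple_def b'_def)
    have "coef b a > 0" using a(2) form_root_pos[OF aP] by (simp add: coef_def)
    moreover have "0 < a \<cdot> f" using a(1) by (simp add: simple_def pos_def)
    ultimately have lower: "b' \<cdot> f < b \<cdot> f" by (simp add: b'_def reflect_def form_simps)
    have "card {c. pos f c \<and> c \<cdot> f < b' \<cdot> f} < card {c. pos f c \<and> c \<cdot> f < b \<cdot> f}"
    proof (rule psubset_card_mono)
      show "finite {c. pos f c \<and> c \<cdot> f < b \<cdot> f}"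
        by (rule finite_subset[OF _ finite_Phi]) (auto simp: pos_def)
      show "{c. pos f c \<and> c \<cdot> f < b' \<cdot> f} \<subset> {c. pos f c \<and> c \<cdot> f < b \<cdot> f}"
        using lower b' by force
    qed
    from less.hyps[OF this b'] obtain as where
      as: "\<forall>a\<in>set as. simple f a" "odd (length as)" "word as = reflect b'" by blast
    have "word (a # as @ [a]) x = reflect b x" for x
    proof -
      have "word [a] (reflect b (reflect a x)) = reflect (word [a] b) (word [a] (reflect a x))"
        using aP by (intro word_conj_reflect) auto
      then have "reflect b' x = reflect a (reflect b (reflect a x))" using aP by (simp add: b'_def)
      then have *: "reflect b' y = reflect a (reflect b (reflect a y))" if "y = x" for y using that by simp
      have "reflect b' (reflect a x) = reflect a (reflect b x)"
        using word_conj_reflect[of "[a]" b x] aP by (simp add: b'_def)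
      then show ?thesis using as(3) aP by simp
    qed
    then have "word (a # as @ [a]) = reflect b" by (rule ext)
    then show ?thesis using a(1) as by (intro exI[of _ "a # as @ [a]"]) simp
  qed
qed

lemma word_eq_simple_word:
  assumes f: "regular f"
  shows "set bs \<subseteq> Phi \<Longrightarrow> \<exists>as. (\<forall>a\<in>set as. simple f a) \<and>
            even (length as + length bs) \<and> word as = word bs"
proof (induction bs)
  case Nil
  then show ?case by (intro exI[of _ "[]"]) simp
next
  case (Cons b bs)
  then obtain as where as: "\<forall>a\<in>set as. simple f a" "even (length as + length bs)" "word as = word bs"
    by auto
  have "\<exists>cs. (\<forall>a\<in>set cs. simple f a) \<and> odd (length cs) \<and> word cs = reflect b"
    using pos_cases[OF f, of b] reflect_eq_simple_word_pos[OF f, of b]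
      reflect_eq_simple_word_pos[OF f, of "- b"] Cons.prems by (auto simp: reflect_uminus_root)
  then obtain cs where "\<forall>a\<in>set cs. simple f a" "odd (length cs)" "word cs = reflect b" by blast
  then show ?case using as by (intro exI[of _ "cs @ as"]) auto
qed

section \<open>Elements fixing a regular vector\<close>

lemma sign_change:
  assumes f: "regular f" and as: "\<forall>c\<in>set as. simple f c" and b: "pos f b" and neg: "\<not> pos f (word as b)"
  shows "\<exists>us c vs. as = us @ c # vs \<and> pos f (word vs b) \<and> \<not> pos f (reflect c (word vs b))"
  using as neg
proof (induction as)
  case Nil
  then show ?case using b by simp
next
  case (Cons a as)
  show ?case
  proof (cases "pos f (word as b)")
    case True
    then show ?thesis using Cons.prems by (intro exI[of _ "[]"]) auto
  next
    case False
    then obtain us c vs where "as = us @ c # vs" "pos f (word vs b)" "\<not> pos f (reflect c (word vs b))"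
      using Cons by auto
    then show ?thesis by (intro exI[of _ "a # us"]) auto
  qed
qed

text \<open>
  The deletion argument. Let \<open>a\<close> be the last letter. As \<open>s\<^sub>a\<close> makes \<open>a\<close> negative and the word does
  not, some letter \<open>c\<close> before it changes the sign back. Since \<open>c\<close> is simple, the root that it acts
  on is a multiple of \<open>c\<close>; so the part between \<open>c\<close> and \<open>a\<close> conjugates \<open>s\<^sub>a\<close> into \<open>s\<^sub>c\<close>, and both
  letters cancel.
\<close>

lemma simple_word_trivial:
  assumes f: "regular f"
  shows "\<lbrakk>\<forall>a\<in>set as. simple f a; \<And>b. pos f b \<Longrightarrow> pos f (word as b)\<rbrakk>
           \<Longrightarrow> word as = id \<and> even (length as)"
proof (induction "length as" arbitrary: as rule: less_induct)
  case less
  show ?case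
  proof (cases as rule: rev_cases)
    case Nil
    then show ?thesis by simp
  next
    case (snoc bs a)
    have sa: "simple f a" and sbs: "\<forall>a\<in>set bs. simple f a" using less.prems snoc by auto
    have aP: "a \<in> Phi" and pa: "pos f a" using sa by (auto simp: simple_def pos_def)
    have "word as a = - word bs a" using aP by (simp add: snoc reflect_self word_minus)
    then have "\<not> pos f (word bs a)" using less.prems(2)[OF pa] by (auto simp: pos_def form_minus)
    from sign_change[OF f sbs pa this] obtain us c vs where
      bs: "bs = us @ c # vs" and v: "pos f (word vs a)" "\<not> pos f (reflect c (word vs a))" by blast
    have sc: "simple f c" and cP: "c \<in> Phi" and vsP: "set vs \<subseteq> Phi"
      using sbs bs simple_in_Phi by auto
    obtain t where t: "word vs a = t *s c" using v sc by (auto simp: simple_def)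
    have "word vs a \<noteq> 0" using v(1) zero_notin_Phi by (auto simp: pos_def)
    then have "t \<noteq> 0" using t by auto
    then have rc: "reflect (word vs a) = reflect c" by (simp add: t reflect_scaled_root)
    have "word as x = word (us @ vs) x" for x
      using word_conj_reflect[OF vsP, of a x] cP by (simp add: snoc bs rc)
    then have eq: "word as = word (us @ vs)" by (rule ext)
    have "word (us @ vs) = id \<and> even (length (us @ vs))"
    proof (rule less.hyps)
      show "length (us @ vs) < length as" by (simp add: snoc bs)
      show "\<forall>a\<in>set (us @ vs). simple f a" using sbs bs by auto
      show "pos f (word (us @ vs) b)" if "pos f b" for b using less.prems(2)[OF that] eq by simp
    qed
    then show ?thesis using eq by (simp add: snoc bs)
  qed
qed

text \<open>
  An element that fixes \<open>f\<close> preserves the form and hence the sign of every root with respect to \<open>f\<close>.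
\<close>

theorem regular_stabilizer:
  assumes f: "regular f" and bs: "set bs \<subseteq> Phi" and stab: "word bs f = f"
  shows "word bs = id" "even (length bs)"
proof -
  obtain as where as: "\<forall>a\<in>set as. simple f a" "even (length as + length bs)" "word as = word bs"
    using word_eq_simple_word[OF f bs] by blast
  have "pos f (word as b)" if "pos f b" for b
    using form_word[OF bs, of b f] word_in_Phi[OF bs, of b] that by (simp add: pos_def stab as(3))
  from simple_word_trivial[OF f as(1) this]
  show "word bs = id" "even (length bs)" using as by auto
qed

text \<open>
  A vector space over an infinite field is not a finite union of proper subspaces: given a vector
  \<open>f\<close> that suits \<open>A\<close> and a vector \<open>x\<close> that suits \<open>a\<close>, all but finitely many \<open>x + t f\<close> suit both.
\<close>

lemma exists_generic:
  assumes S: "subspace S" and fin: "finite A" and A: "\<And>a. a \<in> A \<Longrightarrow> \<exists>x\<in>S. a \<cdot> x \<noteq> 0"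
  shows "\<exists>f\<in>S. \<forall>a\<in>A. a \<cdot> f \<noteq> 0"
  using fin A
proof (induction A)
  case empty
  then show ?case using subspace_0[OF S] by auto
next
  case (insert a A)
  then obtain f where f: "f \<in> S" "\<forall>a\<in>A. a \<cdot> f \<noteq> 0" by auto
  obtain x where x: "x \<in> S" "a \<cdot> x \<noteq> 0" using insert.prems by auto
  obtain t where t: "t \<notin> (\<lambda>b. - (b \<cdot> x) / (b \<cdot> f)) ` insert a A"
    using ex_new_if_finite[of "(\<lambda>b. - (b \<cdot> x) / (b \<cdot> f)) ` insert a A"] insert.hyps infinite_UNIV_char_0
    by (metis finite_imageI finite_insert)
  have "b \<cdot> (x + t *s f) \<noteq> 0" if b: "b \<in> insert a A" for b
  proof (cases "b \<cdot> f = 0")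
    case True
    then have "b = a" using b f(2) by auto
    then show ?thesis using True x(2) by (simp add: form_simps)
  next
    case False
    have "t \<noteq> - (b \<cdot> x) / (b \<cdot> f)" using t b by auto
    then show ?thesis using False by (simp add: form_simps field_simps)
  qed
  then show ?case using S f(1) x(1) subspace_add subspace_scale by (intro bexI[of _ "x + t *s f"]) auto
qed

lemma exists_regular: "\<exists>f \<in> span Phi. regular f"
proof -
  have "\<exists>x\<in>span Phi. a \<cdot> x \<noteq> 0" if "a \<in> Phi" for a
    using that form_root_pos[of a] span_base[of a Phi] by (intro bexI[of _ a]) auto
  from exists_generic[OF subspace_span finite_Phi this] show ?thesis by (auto simp: regular_def)
qed

text \<open>
  The word \<open>as\<close> followed by the inverse of \<open>bs\<close> fixes a regular vector in the span of the roots.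
\<close>

theorem word_parity:
  assumes as: "set as \<subseteq> Phi" and bs: "set bs \<subseteq> Phi"
    and eq: "\<And>x. x \<in> Phi \<Longrightarrow> word as x = word bs x"
  shows "even (length as + length bs)"
proof -
  have eq_span: "word as x = word bs x" if "x \<in> span Phi" for x
    using that by (induction rule: span_induct_alt) (auto simp: word_linear eq)
  obtain f where f: "f \<in> span Phi" "regular f" using exists_regular by blast
  have "word (rev bs @ as) f = f" using eq_span[OF f(1)] word_rev[OF bs] by simp
  from regular_stabilizer(2)[OF f(2) _ this] show ?thesis using as bs by (auto simp: add.commute)
qed

section \<open>Elements as products of few reflections\<close>

text \<open>
  Otherwise no root is orthogonal to the fixed space, so the fixed space contains a regular vector.
\<close>

lemma root_orthogonal_to_fixed_space:
  assumes as: "set as \<subseteq> Phi" and ne: "word as \<noteq> id"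
  obtains a where "a \<in> Phi" "\<And>x. \<lbrakk>x \<in> span Phi; word as x = x\<rbrakk> \<Longrightarrow> a \<cdot> x = 0"
proof (rule ccontr)
  assume none: "\<not> thesis"
  define S where "S = {x \<in> span Phi. word as x = x}"
  have S: "subspace S" unfolding S_def subspace_def
    by (auto simp: span_zero span_add span_scale word_linear)
  have "\<exists>x\<in>S. a \<cdot> x \<noteq> 0" if "a \<in> Phi" for a
    using none that[THEN \<open>\<And>a. \<lbrakk>a \<in> Phi; \<And>x. \<lbrakk>x \<in> span Phi; word as x = x\<rbrakk> \<Longrightarrow> a \<cdot> x = 0\<rbrakk> \<Longrightarrow> thesis\<close>]
    by (auto simp: S_def)
  from exists_generic[OF S finite_Phi this] obtain f where "f \<in> S" "regular f"
    by (auto simp: regular_def)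
  then show False using regular_stabilizer(1)[OF _ as] ne by (auto simp: S_def)
qed

lemma word_periodic:
  assumes as: "set as \<subseteq> Phi" and a: "a \<in> Phi"
  obtains d where "0 < d" "(word as ^^ d) a = a"
proof -
  define u where "u = word as"
  have inP: "(u ^^ i) a \<in> Phi" for i
    by (induction i) (auto simp: a u_def word_in_Phi[OF as])
  have "\<not> inj (\<lambda>i::nat. (u ^^ i) a)"
    using finite_subset[OF _ finite_Phi, of "range (\<lambda>i. (u ^^ i) a)"] inP finite_imageD[of _ UNIV]
    by (metis (no_types, lifting) image_subset_iff infinite_UNIV_nat)
  then obtain i j where ij: "i < j" "(u ^^ i) a = (u ^^ j) a"
    unfolding inj_on_def by (metis linorder_neqE_nat)
  have "inj u" unfolding u_def using word_rev[OF as] by (metis injI)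
  then have "inj (u ^^ i)" by (rule inj_fn)
  moreover have "(u ^^ i) ((u ^^ (j - i)) a) = (u ^^ i) a"
    using ij by (metis comp_apply funpow_add le_add_diff_inverse less_imp_le_nat)
  ultimately have "(u ^^ (j - i)) a = a" by (rule injD)
  then show ?thesis using that[of "j - i"] ij u_def by auto
qed

text \<open>
  On a space with definite form, the image of \<open>w - 1\<close> is the orthogonal complement of the fixed space
  of \<open>w\<close>. A preimage of a multiple of \<open>a\<close> can be written down with the period \<open>d\<close> of \<open>a\<close> under \<open>w\<close>:
  the sum of the orbit of \<open>a\<close> is fixed by \<open>w\<close> and also orthogonal to all fixed vectors, so it is
  zero, and therefore \<open>d a\<close> is the sum of all \<open>a - w\<^sup>i a\<close>, each of which is in the image of
  \<open>w - 1\<close> by telescoping.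
\<close>

lemma displacement_vector:
  assumes as: "set as \<subseteq> Phi" and a: "a \<in> Phi"
    and orth: "\<And>x. \<lbrakk>x \<in> span Phi; word as x = x\<rbrakk> \<Longrightarrow> a \<cdot> x = 0"
  obtains v t where "v \<in> span Phi" "t \<noteq> 0" "word as v = v + t *s a"
    "\<And>x. \<lbrakk>x \<in> span Phi; word as x = x\<rbrakk> \<Longrightarrow> v \<cdot> x = 0"
proof -
  obtain d where d: "0 < d" "(word as ^^ d) a = a" using word_periodic[OF as a] .
  define p where "p i = (word as ^^ i) a" for i
  have p_Suc: "word as (p i) = p (Suc i)" for i by (simp add: p_def)
  have pP: "p i \<in> span Phi" for i
    by (induction i) (auto simp: p_def a span_base word_in_span[OF as])
  have p_orth: "p i \<cdot> x = 0" if "x \<in> span Phi" "word as x = x" for i x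
  proof (induction i)
    case 0
    then show ?case using orth that by (simp add: p_def)
  next
    case (Suc i)
    then show ?case using form_word[OF as, of "p i" x] that by (simp add: p_Suc)
  qed
  have tele: "word as (\<Sum>j<i. p j) + p 0 = (\<Sum>j<i. p j) + p i" for i
    by (induction i) (simp_all add: word_sum word_linear p_Suc ac_simps)
  have pd: "p d = p 0" using d by (simp add: p_def)
  define s where "s = (\<Sum>i<d. p i)"
  have sP: "s \<in> span Phi" by (simp add: s_def span_sum pP)
  have ws: "word as s = s" using tele[of d] pd by (simp add: s_def)
  have "s \<cdot> s = (\<Sum>i<d. p i \<cdot> s)" unfolding s_def by (rule form_sum(1))
  then have "s \<cdot> s = 0" using p_orth[OF sP ws] by simp
  \<comment> \<open>\<open>s\<close> is a fixed vector and orthogonal to the fixed vectors\<close>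
  then have s0: "s = 0" using form_pos[OF sP] by force
  define v where "v = - (\<Sum>i<d. \<Sum>j<i. p j)"
  have c: "(\<Sum>i<d. c) = of_nat d *s c" for c
    by (induction d) (auto simp: scale_left_distrib algebra_simps)
  have "word as (\<Sum>i<d. \<Sum>j<i. p j) + (\<Sum>i<d. p 0) = (\<Sum>i<d. word as (\<Sum>j<i. p j) + p 0)"
    by (simp add: word_sum sum.distrib)
  also have "\<dots> = (\<Sum>i<d. \<Sum>j<i. p j) + s" by (simp add: tele sum.distrib s_def)
  finally have "word as (\<Sum>i<d. \<Sum>j<i. p j) + of_nat d *s a = (\<Sum>i<d. \<Sum>j<i. p j)"
    using c[of "p 0"] s0 by (simp add: p_def)
  then have "word as v = v + of_nat d *s a"
    unfolding v_def word_minus by (metis add_diff_cancel_right' diff_minus_eq_add minus_diff_eq add.commute uminus_add_conv_diff)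
  moreover have "v \<in> span Phi" by (auto simp: v_def intro!: span_neg span_sum pP)
  moreover have "v \<cdot> x = 0" if "x \<in> span Phi" "word as x = x" for x
    using p_orth[OF that] by (simp add: v_def form_simps)
  ultimately show ?thesis using that[of v "of_nat d"] d(1) by auto
qed


lemma orthogonal_independent:
  assumes "pairwise (\<lambda>x y. x \<cdot> y = 0) X" and sub: "X \<subseteq> span Phi" and "0 \<notin> X"
  shows "independent X"
  unfolding independent_explicit_finite_subsets
proof (intro allI impI ballI)
  fix S u v assume S: "S \<subseteq> X" "finite S" and 0: "(\<Sum>v\<in>S. u v *s v) = 0" and v: "v \<in> S"
  have vv: "0 < v \<cdot> v" using form_pos v S assms by (metis subsetD)
  have "0 = (\<Sum>x\<in>S. u x *s x) \<cdot> v" by (simp add: 0)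
  also have "\<dots> = (\<Sum>x\<in>S. u x * (x \<cdot> v))" by (simp add: form_simps)
  also have "\<dots> = (\<Sum>x\<in>S. if x = v then u v * (v \<cdot> v) else 0)"
    using assms(1) v S by (intro sum.cong) (auto simp: pairwise_def)
  also have "\<dots> = u v * (v \<cdot> v)" using S v by simp
  finally show "u v = 0" using vv by auto
qed

text \<open>
  Induction on the number of dimensions left after a family \<open>X\<close> of orthogonal vectors fixed by \<open>w\<close>.
  With a root \<open>a\<close> orthogonal to the fixed space and \<open>v\<close> such that \<open>w v - v\<close> is a multiple of \<open>a\<close>, the
  vectors \<open>v\<close> and \<open>w v\<close> have the same length, so \<open>s\<^sub>a\<close> interchanges them. Hence \<open>s\<^sub>a w\<close> fixes \<open>v\<close>,
  and it still fixes \<open>X\<close>; as \<open>v\<close> is orthogonal to \<open>X\<close>, it may be added to the family.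
\<close>

lemma word_length_bound_aux:
  assumes T: "finite T" "Phi \<subseteq> span T"
  shows "\<lbrakk>set as \<subseteq> Phi; finite X; pairwise (\<lambda>x y. x \<cdot> y = 0) X; X \<subseteq> span Phi; 0 \<notin> X;
          \<And>x. x \<in> X \<Longrightarrow> word as x = x\<rbrakk>
    \<Longrightarrow> \<exists>bs. set bs \<subseteq> Phi \<and> word bs = word as \<and> length bs + card X \<le> card T"
proof (induction "card T - card X" arbitrary: as X rule: less_induct)
  case less
  note as = less.prems(1) and X = less.prems(2-5) and fixes_X = less.prems(6)
  have bound: "card Y \<le> card T" if "pairwise (\<lambda>x y. x \<cdot> y = 0) Y" "Y \<subseteq> span Phi" "0 \<notin> Y" for Y
    using independent_span_bound[OF T(1) orthogonal_independent[OF that]] that(2) T(2)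
    by (metis span_minimal subspace_span subset_trans)
  show ?case
  proof (cases "word as = id")
    case True
    then show ?thesis using bound[OF X(2-4)] by (intro exI[of _ "[]"]) simp
  next
    case False
    obtain a where a: "a \<in> Phi" and orth: "\<And>x. \<lbrakk>x \<in> span Phi; word as x = x\<rbrakk> \<Longrightarrow> a \<cdot> x = 0"
      using root_orthogonal_to_fixed_space[OF as False] by blast
    obtain v t where v: "v \<in> span Phi" "t \<noteq> 0" "word as v = v + t *s a"
      and v_orth: "\<And>x. \<lbrakk>x \<in> span Phi; word as x = x\<rbrakk> \<Longrightarrow> v \<cdot> x = 0"
      using displacement_vector[OF as a orth] by blast
    have "a \<noteq> 0" using a zero_notin_Phi by auto
    then have v0: "v \<noteq> 0" using v by auto
    then have vX: "v \<notin> X" using v_orth fixes_X X(3) form_pos[OF v(1)] by force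
    have fix_v: "word (a # as) v = v"
    proof -
      have "v \<cdot> v = (v + t *s a) \<cdot> (v + t *s a)" using form_word[OF as, of v v] v(3) by simp
      then have "t * (2 * (v \<cdot> a) + t * (a \<cdot> a)) = 0"
        by (simp add: form_simps form_commute[of a v] algebra_simps)
      then have "2 * (v \<cdot> a) = - t * (a \<cdot> a)" using v(2) by auto
      \<comment> \<open>so \<open>s\<^sub>a\<close> moves \<open>v\<close> to \<open>v + t a\<close>, that is, to \<open>w v\<close>\<close>
      then have "coef v a = - t" using form_root_pos[OF a] by (simp add: coef_def)
      moreover have "coef (v + t *s a) a = coef v a + 2 * t"
        using form_root_pos[OF a] by (simp add: coef_def form_simps field_simps)
      ultimately show ?thesis using v(3) by (simp add: reflect_def)
    qed
    have fix': "word (a # as) x = x" if "x \<in> insert v X" for x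
      using that fix_v fixes_X[of x] orth[of x] X(3) by (auto simp: reflect_def coef_def form_commute[of x a])
    let ?X = "insert v X"
    have X': "finite ?X" "pairwise (\<lambda>x y. x \<cdot> y = 0) ?X" "?X \<subseteq> span Phi" "0 \<notin> ?X"
      using X v(1) v0 v_orth fixes_X by (auto simp: pairwise_insert form_commute[of _ v])
    have card': "card ?X = Suc (card X)" using X(1) vX by simp
    have "card T - card ?X < card T - card X" using bound[OF X'(2-4)] card' by simp
    from less.hyps[OF this _ X' fix'] as a obtain bs where
      bs: "set bs \<subseteq> Phi" "word bs = word (a # as)" "length bs + card ?X \<le> card T" by auto
    have "word (a # bs) = word as" using bs(2) a by (auto simp: fun_eq_iff)
    then show ?thesis using bs card' a by (intro exI[of _ "a # bs"]) auto
  qed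
qed

theorem word_length_bound:
  assumes as: "set as \<subseteq> Phi"
  obtains A bs where "A \<subseteq> Phi" "independent A" "set bs \<subseteq> Phi" "word bs = word as" "length bs \<le> card A"
proof -
  obtain A where A: "A \<subseteq> Phi" "independent A" "Phi \<subseteq> span A" by (rule maximal_independent_subset)
  have "\<exists>bs. set bs \<subseteq> Phi \<and> word bs = word as \<and> length bs + card ({} :: 'v set) \<le> card A"
    using A as finite_subset[OF A(1) finite_Phi] by (intro word_length_bound_aux) auto
  then show ?thesis using that A by auto
qed

end


section \<open>Positive definite root lattices\<close>

text \<open>
  A constant of its own, because in rewriting a bare abstraction would match every function whose
  values are products.
\<close>

definition fun_scale :: "rat \<Rightarrow> ('i \<Rightarrow> rat) \<Rightarrow> 'i \<Rightarrow> rat" where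
  "fun_scale c f = (\<lambda>i. c * f i)"

lemma fun_scale_apply [simp]: "fun_scale c f i = c * f i"
  by (simp add: fun_scale_def)

interpretation fun_space: vector_space fun_scale
  by unfold_locales (auto simp: fun_eq_iff algebra_simps)

lemma sum_fun_apply: "(\<Sum>j\<in>J. g j) i = (\<Sum>j\<in>J. g j i)"
  by (induction J rule: infinite_finite_induct) auto

definition refl_product :: "('a, 'b) monoid_scheme \<Rightarrow> ('a \<Rightarrow> 'a \<Rightarrow> rat) \<Rightarrow> 'a list \<Rightarrow> 'a \<Rightarrow> 'a" where
  "refl_product L B as = foldr (compose (carrier L)) (map (reflection L B) as) (\<lambda>x\<in>carrier L. x)"

lemma is_presentation_iff:
  "is_presentation L B R w as \<longleftrightarrow> set as \<subseteq> R \<and> w = refl_product L B as"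
  by (simp add: is_presentation_def refl_product_def)

lemma refl_product_Nil: "x \<in> carrier L \<Longrightarrow> refl_product L B [] x = x"
  and refl_product_Cons:
    "x \<in> carrier L \<Longrightarrow> refl_product L B (a # as) x = reflection L B a (refl_product L B as x)"
  by (simp_all add: refl_product_def compose_def)

lemma refl_product_extensional: "refl_product L B as \<in> extensional (carrier L)"
  by (cases as) (auto simp: refl_product_def)

text \<open>
  The pairings with a root are required to be integers on the whole lattice, so that
  \<^const>\<open>reflection\<close>, in which they are rounded, is additive.
\<close>

locale finite_root_lattice = comm_group M for M (structure) +
  fixes B :: "'a \<Rightarrow> 'a \<Rightarrow> rat" and R :: "'a set"
  assumes form_add_left:
      "\<lbrakk>x \<in> carrier M; y \<in> carrier M; z \<in> carrier M\<rbrakk> \<Longrightarrow> B (x \<otimes> y) z = B x z + B y z"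
    and form_sym: "\<lbrakk>x \<in> carrier M; y \<in> carrier M\<rbrakk> \<Longrightarrow> B x y = B y x"
    and form_pos: "\<lbrakk>x \<in> carrier M; x \<noteq> \<one>\<rbrakk> \<Longrightarrow> 0 < B x x"
    and finite_roots: "finite R"
    and roots_subset: "R \<subseteq> carrier M - {\<one>}"
    and roots_generate: "generate M R = carrier M"
    and roots_reflection: "\<lbrakk>a \<in> R; b \<in> R\<rbrakk> \<Longrightarrow> reflection M B a b \<in> R"
    and pairing_Ints: "\<lbrakk>a \<in> R; x \<in> carrier M\<rbrakk> \<Longrightarrow> pairing B x a \<in> \<int>"
begin

lemma root_closed: "a \<in> R \<Longrightarrow> a \<in> carrier M"
  using roots_subset by auto

lemma root_norm_pos: "a \<in> R \<Longrightarrow> 0 < B a a"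
  using form_pos[of a] roots_subset by auto

lemma form_one: "x \<in> carrier M \<Longrightarrow> B \<one> x = 0"
  using form_add_left[of \<one> \<one> x] by simp

lemma form_inv: "\<lbrakk>x \<in> carrier M; y \<in> carrier M\<rbrakk> \<Longrightarrow> B (inv x) y = - B x y"
  using form_add_left[of x "inv x" y] form_one[of y] by simp

lemma form_nat_pow:
  "\<lbrakk>x \<in> carrier M; y \<in> carrier M\<rbrakk> \<Longrightarrow> B (x [^] (k::nat)) y = of_nat k * B x y"
  by (induction k) (simp_all add: form_one form_add_left algebra_simps)

lemma form_int_pow:
  "\<lbrakk>x \<in> carrier M; y \<in> carrier M\<rbrakk> \<Longrightarrow> B (x [^] (k::int)) y = of_int k * B x y"
  by (cases k rule: int_cases2) (simp_all add: int_pow_int int_pow_neg_int form_inv form_nat_pow)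

lemma form_eqI:
  assumes x: "x \<in> carrier M" and y: "y \<in> carrier M" and eq: "\<And>z. z \<in> R \<Longrightarrow> B x z = B y z"
  shows "x = y"
proof -
  define d where "d = x \<otimes> inv y"
  have d: "d \<in> carrier M" using x y by (simp add: d_def)
  have dR: "B d z = 0" if "z \<in> R" for z
    using that x y by (simp add: d_def form_add_left form_inv root_closed eq)
  have "B z d = 0" if "z \<in> generate M R" for z
    using that
  proof induction
    case one
    then show ?case using form_one d by simp
  next
    case (incl h)
    then show ?case using dR[OF incl] form_sym[OF root_closed[OF incl] d] by simp
  next
    case (inv h)
    then show ?case using dR[OF inv] form_sym[OF root_closed[OF inv] d] d root_closed[OF inv]
      by (simp add: form_inv)
  next
    case (eng h1 h2)
    then show ?case using d roots_generate by (simp add: form_add_left)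
  qed
  then have "B d d = 0" using d roots_generate by simp
  then have "d = \<one>" using form_pos[OF d] by force
  then show ?thesis using x y by (simp add: d_def inv_solve_right')
qed

lemma reflection_closed: "\<lbrakk>a \<in> R; x \<in> carrier M\<rbrakk> \<Longrightarrow> reflection M B a x \<in> carrier M"
  by (simp add: reflection_def root_closed)

lemma form_reflection:
  assumes a: "a \<in> R" and x: "x \<in> carrier M" and y: "y \<in> carrier M"
  shows "B (reflection M B a x) y = B x y - pairing B x a * B a y"
proof -
  have "of_int \<lfloor>pairing B x a\<rfloor> = pairing B x a" using pairing_Ints[OF a x] by (auto elim: Ints_cases)
  then show ?thesis using x y root_closed[OF a]
    by (simp add: reflection_def form_add_left form_inv form_int_pow)
qed

lemma form_reflection_adjoint:
  assumes a: "a \<in> R" and x: "x \<in> carrier M" and y: "y \<in> carrier M"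
  shows "B (reflection M B a x) y = B x (reflection M B a y)"
proof -
  have "B x (reflection M B a y) = B (reflection M B a y) x"
    using a x y by (intro form_sym reflection_closed)
  then show ?thesis using form_sym[OF x y] form_sym[OF root_closed[OF a] y] form_sym[OF root_closed[OF a] x]
    by (simp add: form_reflection a x y pairing_def)
qed

lemma reflection_involution:
  assumes a: "a \<in> R" and x: "x \<in> carrier M"
  shows "reflection M B a (reflection M B a x) = x"
proof (rule form_eqI)
  have "pairing B (reflection M B a x) a = - pairing B x a"
    using root_norm_pos[OF a] by (simp add: pairing_def form_reflection a x root_closed field_simps)
  then show "B (reflection M B a (reflection M B a x)) z = B x z" if "z \<in> R" for z
    using that by (simp add: form_reflection a x root_closed reflection_closed)
qed (simp_all add: a x reflection_closed)

text \<open>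
  The lattice is embedded into the functions on its roots, where vectors can be divided and the
  theory of \<^locale>\<open>root_system\<close> applies. The form \<open>B\<close> is not given on that function space, but
  the sum over all roots of the products of coordinates is, and it is as good: reflections permute
  the roots, so it is invariant under them, and every invariant form yields the same reflections.
\<close>

definition coords :: "'a \<Rightarrow> 'a \<Rightarrow> rat" where
  "coords x = (\<lambda>y. if y \<in> R then B x y else 0)"

definition coord_form :: "('a \<Rightarrow> rat) \<Rightarrow> ('a \<Rightarrow> rat) \<Rightarrow> rat" where
  "coord_form f g = (\<Sum>y\<in>R. f y * g y)"

lemma coords_inj: "\<lbrakk>x \<in> carrier M; y \<in> carrier M; coords x = coords y\<rbrakk> \<Longrightarrow> x = y"
  by (rule form_eqI) (auto simp: coords_def fun_eq_iff split: if_splits)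

lemma coords_reflection:
  "\<lbrakk>a \<in> R; x \<in> carrier M\<rbrakk> \<Longrightarrow>
   coords (reflection M B a x) = coords x - fun_scale (pairing B x a) (coords a)"
  by (auto simp: coords_def fun_eq_iff form_reflection root_closed)

lemma coord_form_reflection:
  assumes a: "a \<in> R" and x: "x \<in> carrier M" and y: "y \<in> carrier M"
  shows "coord_form (coords (reflection M B a x)) (coords (reflection M B a y))
         = coord_form (coords x) (coords y)"
proof -
  have bij: "bij_betw (reflection M B a) R R"
    by (rule bij_betw_byWitness[of _ "reflection M B a"])
       (auto simp: a reflection_involution root_closed roots_reflection)
  have "coord_form (coords (reflection M B a x)) (coords (reflection M B a y))
      = (\<Sum>z\<in>R. B x (reflection M B a z) * B y (reflection M B a z))"
    by (auto simp: coord_form_def coords_def form_reflection_adjoint a x y root_closed intro!: sum.cong)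
  also have "\<dots> = (\<Sum>z\<in>R. B x z * B y z)"
    by (rule sum.reindex_bij_betw[OF bij])
  finally show ?thesis by (simp add: coord_form_def coords_def)
qed

lemma coord_form_pos:
  assumes "\<And>y. y \<notin> R \<Longrightarrow> f y = 0" and "f \<noteq> 0"
  shows "0 < coord_form f f"
proof -
  obtain y where "f y \<noteq> 0" using assms(2) by (auto simp: fun_eq_iff)
  moreover from this have "y \<in> R" using assms(1) by blast
  ultimately show ?thesis unfolding coord_form_def
    by (intro sum_pos2[OF finite_roots, of y]) (auto simp: zero_less_mult_iff)
qed

text \<open>
  Put \<open>I = \<langle>x, a\<rangle>\<close> and \<open>A = \<langle>a, a\<rangle>\<close> for the coordinate form and let \<open>p\<close> be the pairing by \<open>B\<close>. The reflection
  preserves \<open>I\<close>, but it sends \<open>a\<close> to \<open>- a\<close> and \<open>x\<close> to \<open>x - p a\<close>; hence \<open>I = p A - I\<close>.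
\<close>

lemma pairing_eq_coord_form:
  assumes a: "a \<in> R" and x: "x \<in> carrier M"
  shows "2 * coord_form (coords x) (coords a) / coord_form (coords a) (coords a) = pairing B x a"
proof -
  let ?I = "coord_form (coords x) (coords a)" and ?A = "coord_form (coords a) (coords a)"
  have aM: "a \<in> carrier M" using a by (rule root_closed)
  have "coords a a \<noteq> 0" using root_norm_pos[OF a] a by (simp add: coords_def)
  then have "coords a \<noteq> 0" by (metis zero_fun_apply)
  then have A: "0 < ?A" by (intro coord_form_pos) (auto simp: coords_def)
  have "pairing B a a = 2" using root_norm_pos[OF a] by (simp add: pairing_def)
  then have a': "coords (reflection M B a a) i = - coords a i" for i
    by (simp add: coords_reflection a aM)
  have "?I = coord_form (coords (reflection M B a x)) (coords (reflection M B a a))"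
    by (simp add: coord_form_reflection a x aM)
  also have "\<dots> = pairing B x a * ?A - ?I"
    by (simp add: coord_form_def a' coords_reflection[OF a x] left_diff_distrib sum_subtractf
        sum_distrib_left mult.assoc sum_negf)
  finally show ?thesis using A by (simp add: field_simps)
qed

sublocale RS: root_system fun_scale coord_form "coords ` R"
proof unfold_locales
  fix x y z :: "'a \<Rightarrow> rat" and c :: rat
  show "coord_form (x + y) z = coord_form x z + coord_form y z"
    by (simp add: coord_form_def distrib_right sum.distrib)
  show "coord_form (fun_scale c x) y = c * coord_form x y"
    by (simp add: coord_form_def sum_distrib_left mult.assoc)
  show "coord_form x y = coord_form y x" by (simp add: coord_form_def mult.commute)
  show "0 < coord_form x x" if "x \<in> fun_space.span (coords ` R)" "x \<noteq> 0"
  proof (rule coord_form_pos)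
    show "x y = 0" if "y \<notin> R" for y
      using \<open>x \<in> fun_space.span (coords ` R)\<close> that
      by (induction rule: fun_space.span_induct_alt) (auto simp: coords_def)
  qed fact
  show "finite (coords ` R)" using finite_roots by simp
  show "0 \<notin> coords ` R"
  proof
    assume "0 \<in> coords ` R"
    then obtain a where a: "a \<in> R" "coords a = 0" by auto
    then have "coords a a = 0" by simp
    then show False using root_norm_pos[OF a(1)] a(1) by (simp add: coords_def)
  qed
  show "b - fun_scale (2 * coord_form b a / coord_form a a) a \<in> coords ` R"
    if mem: "a \<in> coords ` R" "b \<in> coords ` R" for a b
  proof -
    obtain a' b' where ab: "a = coords a'" "b = coords b'" "a' \<in> R" "b' \<in> R" using mem by blast
    then have "b - fun_scale (2 * coord_form b a / coord_form a a) a = coords (reflection M B a' b')"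
      by (simp add: pairing_eq_coord_form coords_reflection root_closed)
    then show ?thesis using roots_reflection ab by auto
  qed
qed

lemma coords_reflect: "\<lbrakk>a \<in> R; x \<in> carrier M\<rbrakk> \<Longrightarrow> coords (reflection M B a x) = RS.reflect (coords a) (coords x)"
  by (simp add: RS.reflect_def RS.coef_def pairing_eq_coord_form coords_reflection)

lemma coords_refl_product:
  "\<lbrakk>set as \<subseteq> R; x \<in> carrier M\<rbrakk> \<Longrightarrow>
   refl_product M B as x \<in> carrier M \<and> coords (refl_product M B as x) = RS.word (map coords as) (coords x)"
  by (induction as) (auto simp: refl_product_Nil refl_product_Cons reflection_closed coords_reflect)

theorem presentation_parity:
  assumes as: "is_presentation M B R w as" and bs: "is_presentation M B R w bs"
  shows "even (length as + length bs)"
proof -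
  have eq: "refl_product M B as = refl_product M B bs" and sub: "set as \<subseteq> R" "set bs \<subseteq> R"
    using as bs by (auto simp: is_presentation_iff)
  have "even (length (map coords as) + length (map coords bs))"
  proof (rule RS.word_parity)
    fix x assume "x \<in> coords ` R"
    then show "RS.word (map coords as) x = RS.word (map coords bs) x"
      using coords_refl_product[OF sub(1)] coords_refl_product[OF sub(2)] eq root_closed by auto
  qed (use sub in auto)
  then show ?thesis by simp
qed

text \<open>
  The roots in \<open>A\<close> are independent in the sense that the functionals \<open>B a\<close> are so over \<open>\<rat>\<close>. In this
  form independence passes without change to representatives in a lattice of which \<open>M\<close> is a quotient.
\<close>

theorem short_presentation:
  assumes as: "is_presentation M B R w as"
  obtains A bs where "finite A" "A \<subseteq> R"
    "\<And>c. \<forall>y\<in>carrier M. (\<Sum>a\<in>A. c a * B a y) = 0 \<Longrightarrow> \<forall>a\<in>A. c a = 0"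
    "is_presentation M B R w bs" "length bs \<le> card A"
proof -
  have sub: "set as \<subseteq> R" and w: "w = refl_product M B as" using as by (auto simp: is_presentation_iff)
  obtain A' bs' where A': "A' \<subseteq> coords ` R" "fun_space.independent A'" "set bs' \<subseteq> coords ` R"
    "RS.word bs' = RS.word (map coords as)" "length bs' \<le> card A'"
    using RS.word_length_bound[of "map coords as"] sub by (metis image_mono list.set_map)
  define bs where "bs = map (inv_into R coords) bs'"
  have "map coords bs = map id bs'"
    unfolding bs_def map_map using A'(3) by (intro map_cong) (auto simp: f_inv_into_f)
  then have bs: "set bs \<subseteq> R" "bs' = map coords bs"
    using A'(3) by (auto simp: bs_def intro!: inv_into_into)
  have "refl_product M B bs = refl_product M B as"
  proof (rule extensionalityI[OF refl_product_extensional refl_product_extensional])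
    fix x assume x: "x \<in> carrier M"
    show "refl_product M B bs x = refl_product M B as x"
      using coords_refl_product[OF sub x] coords_refl_product[OF bs(1) x] A'(4) bs(2)
      by (intro coords_inj) auto
  qed
  then have pres: "is_presentation M B R w bs" using bs(1) w by (simp add: is_presentation_iff)
  define A where "A = {a \<in> R. coords a \<in> A'}"
  have bij: "bij_betw coords A A'"
    unfolding bij_betw_def
  proof
    show "inj_on coords A" using coords_inj root_closed by (auto simp: A_def inj_on_def)
    show "coords ` A = A'" using A'(1) by (auto simp: A_def)
  qed
  have finA: "finite A" using finite_roots by (simp add: A_def)
  show ?thesis
  proof (rule that[OF finA _ _ pres])
    show "A \<subseteq> R" by (auto simp: A_def)
    show "length bs \<le> card A" using A'(5) bs(2) bij_betw_same_card[OF bij] by simp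
    fix c assume c: "\<forall>y\<in>carrier M. (\<Sum>a\<in>A. c a * B a y) = 0"
    define u where "u f = c (the_inv_into A coords f)" for f
    have u: "u (coords a) = c a" if "a \<in> A" for a
      using that bij by (simp add: u_def the_inv_into_f_f bij_betw_def)
    have "(\<Sum>f\<in>A'. fun_scale (u f) f) = (\<Sum>a\<in>A. fun_scale (u (coords a)) (coords a))"
      by (rule sum.reindex_bij_betw[OF bij, symmetric])
    also have "\<dots> = (\<Sum>a\<in>A. fun_scale (c a) (coords a))" by (simp add: u)
    also have "\<dots> = 0"
    proof
      show "(\<Sum>a\<in>A. fun_scale (c a) (coords a)) y = 0 y" for y
        using c root_closed[of y] by (cases "y \<in> R") (simp_all add: sum_fun_apply coords_def)
    qed
    finally have "u f = 0" if "f \<in> A'" for f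
      using A'(2) that finA bij_betw_finite[OF bij] fun_space.independentD[of A' A' u f] by auto
    then show "\<forall>a\<in>A. c a = 0" using u bij by (metis bij_betwE)
  qed
qed

end


section \<open>Independent elements of a free abelian group\<close>

lemma (in vector_space) independent_family_card_le:
  assumes I: "finite I" and T: "finite T" "v ` I \<subseteq> span T"
    and indep: "\<And>q i. \<lbrakk>(\<Sum>j\<in>I. scale (q j) (v j)) = 0; i \<in> I\<rbrakk> \<Longrightarrow> q i = 0"
  shows "card I \<le> card T"
proof -
  have inj: "inj_on v I"
  proof (rule inj_onI, rule ccontr)
    fix i j assume ij: "i \<in> I" "j \<in> I" "v i = v j" "i \<noteq> j"
    define q where "q k = (if k = i then 1 else 0) - (if k = j then 1 else 0 :: 'a)" for k
    have ite: "scale (if P then 1 else 0) x = (if P then x else 0)" for P x by simp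
    have "(\<Sum>k\<in>I. scale (q k) (v k)) = 0"
      using ij I by (simp add: q_def scale_left_diff_distrib sum_subtractf ite)
    from indep[OF this ij(1)] ij(4) show False by (simp add: q_def)
  qed
  have "independent (v ` I)"
  proof (rule independent_if_scalars_zero)
    show "finite (v ` I)" using I by simp
    fix f x assume 0: "(\<Sum>x\<in>v ` I. scale (f x) x) = 0" and x: "x \<in> v ` I"
    have "(\<Sum>i\<in>I. scale (f (v i)) (v i)) = 0" using 0 by (simp add: sum.reindex[OF inj])
    then show "f x = 0" using indep[of "\<lambda>i. f (v i)"] x by auto
  qed
  from independent_span_bound[OF T(1) this T(2)] show ?thesis
    using card_image[OF inj] by simp
qed

lemma common_denominator:
  fixes q :: "'i \<Rightarrow> rat"
  assumes "finite I"
  shows "\<exists>N::int. N \<noteq> 0 \<and> (\<forall>i\<in>I. of_int N * q i \<in> \<int>)"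
  using assms
proof (induction I)
  case empty
  then show ?case by (intro exI[of _ 1]) simp
next
  case (insert i I)
  then obtain N :: int where N: "N \<noteq> 0" "\<forall>i\<in>I. of_int N * q i \<in> \<int>" by blast
  obtain a b where ab: "q i = of_int a / of_int b" "b > 0"
    by (metis quotient_of_div quotient_of_denom_pos surj_pair)
  have "of_int (N * b) * q j \<in> \<int>" if "j \<in> insert i I" for j
  proof (cases "j = i")
    case True
    then have "of_int (N * b) * q j = of_int (N * a)" using ab by simp
    then show ?thesis by (metis Ints_of_int)
  next
    case False
    then have "of_int N * q j \<in> \<int>" using N that by auto
    then have "of_int b * (of_int N * q j) \<in> \<int>" by (rule Ints_mult[OF Ints_of_int])
    then show ?thesis by (simp add: mult_ac)
  qed
  then show ?case using N(1) ab(2) by (intro exI[of _ "N * b"]) auto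
qed

text \<open>
  Independence over \<open>\<int>\<close> of a family, written multiplicatively; in particular its members are distinct.
\<close>

definition int_independent :: "('a, 'b) monoid_scheme \<Rightarrow> 'i set \<Rightarrow> ('i \<Rightarrow> 'a) \<Rightarrow> bool" where
  "int_independent G I u \<longleftrightarrow>
     (\<forall>c :: 'i \<Rightarrow> int. finprod G (\<lambda>i. u i [^]\<^bsub>G\<^esub> c i) I = \<one>\<^bsub>G\<^esub> \<longrightarrow> (\<forall>i\<in>I. c i = 0))"

text \<open>
  The coordinates embed the group into the rational functions on \<open>{..<n}\<close>. Multiplying a rational
  relation by a common denominator shows that independence over \<open>\<int>\<close> becomes independence over \<open>\<rat>\<close>,
  where the number of unit vectors is a bound.
\<close>

lemma (in comm_group) int_independent_card_le_rank:
  fixes u :: "'i \<Rightarrow> 'a"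
  assumes rank: "has_rank G n" and I: "finite I" and u: "\<And>i. i \<in> I \<Longrightarrow> u i \<in> carrier G"
    and indep: "int_independent G I u"
  shows "card I \<le> n"
proof -
  let ?F = "free_Abelian_group {..<n}"
  obtain h where h: "h \<in> iso G ?F" using rank by (auto simp: has_rank_def is_iso_def)
  then interpret h: group_hom G ?F h
    by (auto simp: group_hom_def group_hom_axioms_def iso_def is_group)
  have inj: "inj_on h (carrier G)" using h by (simp add: iso_iff)
  have keys: "Poly_Mapping.keys (h x) \<subseteq> {..<n}" if "x \<in> carrier G" for x
    using h.hom_closed[OF that] by simp
  have h_prod: "h (finprod G (\<lambda>i. u i [^] c i) J) = (\<Sum>i\<in>J. frag_cmul (c i) (h (u i)))"
    if "J \<subseteq> I" for J and c :: "'i \<Rightarrow> int"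
    using finite_subset[OF that I] that
  proof (induction J)
    case empty
    then show ?case using h.hom_one by simp
  next
    case (insert i J)
    have u_pow: "u j [^] c j \<in> carrier G" if "j \<in> insert i J" for j
      using u insert.prems that by blast
    then have "finprod G (\<lambda>i. u i [^] c i) J \<in> carrier G" by (intro finprod_closed) auto
    then show ?case using insert u u_pow keys by (subst finprod_insert) (auto simp: h.hom_int_pow h.hom_mult)
  qed
  define v where "v i = (\<lambda>k. rat_of_int (Poly_Mapping.lookup (h (u i)) k))" for i
  define e :: "nat \<Rightarrow> nat \<Rightarrow> rat" where "e k = (\<lambda>j. if j = k then 1 else 0)" for k
  have "card I \<le> card (e ` {..<n})"
  proof (rule fun_space.independent_family_card_le[OF I])
    show "v ` I \<subseteq> fun_space.span (e ` {..<n})"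
    proof clarify
      fix i assume i: "i \<in> I"
      have "v i = (\<Sum>k<n. fun_scale (v i k) (e k))"
      proof
        fix j
        have "(\<Sum>k<n. fun_scale (v i k) (e k)) j = (\<Sum>k<n. if k = j then v i k else 0)"
          unfolding sum_fun_apply e_def by (intro sum.cong) auto
        also have "\<dots> = v i j"
          using keys[OF u[OF i]] by (auto simp: v_def in_keys_iff subset_iff)
        finally show "v i j = (\<Sum>k<n. fun_scale (v i k) (e k)) j" by simp
      qed
      then show "v i \<in> fun_space.span (e ` {..<n})"
        by (metis (no_types, lifting) fun_space.span_sum fun_space.span_scale fun_space.span_base imageI)
    qed
    fix q i assume 0: "(\<Sum>j\<in>I. fun_scale (q j) (v j)) = 0" and i: "i \<in> I"
    obtain N :: int where N: "N \<noteq> 0" "\<forall>i\<in>I. of_int N * q i \<in> \<int>"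
      using common_denominator[OF I] by blast
    define c where "c j = \<lfloor>of_int N * q j\<rfloor>" for j
    have c: "of_int (c j) = of_int N * q j" if "j \<in> I" for j
      using bspec[OF N(2) that] by (auto simp: c_def elim: Ints_cases)
    have "(\<Sum>j\<in>I. frag_cmul (c j) (h (u j))) = 0"
    proof (rule poly_mapping_eqI)
      fix k
      have "rat_of_int (\<Sum>j\<in>I. c j * Poly_Mapping.lookup (h (u j)) k) = (\<Sum>j\<in>I. of_int N * (q j * v j k))"
        by (simp add: c v_def mult.assoc)
      also have "\<dots> = of_int N * (\<Sum>j\<in>I. fun_scale (q j) (v j)) k"
        by (simp add: sum_fun_apply sum_distrib_left)
      finally have "(\<Sum>j\<in>I. c j * Poly_Mapping.lookup (h (u j)) k) = 0"
        by (simp only: 0 zero_fun_apply mult_zero_right of_int_eq_0_iff)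
      then show "Poly_Mapping.lookup (\<Sum>j\<in>I. frag_cmul (c j) (h (u j))) k = Poly_Mapping.lookup 0 k"
        by (simp add: lookup_sum)
    qed
    then have "h (finprod G (\<lambda>i. u i [^] c i) I) = h \<one>"
      using h_prod[of I c] h.hom_one by simp
    then have "finprod G (\<lambda>i. u i [^] c i) I = \<one>"
      using u by (intro inj_onD[OF inj]) auto
    then have "c i = 0" using indep i by (auto simp: int_independent_def)
    then show "q i = 0" using c[OF i] N(1) by simp
  qed simp
  also have "\<dots> \<le> n" using card_image_le[of "{..<n}" e] by simp
  finally show ?thesis .
qed

section \<open>The quotient by the radical\<close>

context extended_affine_root_lattice
begin

lemma root_closed: "a \<in> R \<Longrightarrow> a \<in> carrier L"
  using roots_subset by auto

lemma root_norm_pos: "a \<in> R \<Longrightarrow> 0 < B a a"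
  using roots_subset form_nonneg[of a] by force

lemma form_add_right:
  "\<lbrakk>x \<in> carrier L; y \<in> carrier L; z \<in> carrier L\<rbrakk> \<Longrightarrow> B z (x \<otimes> y) = B z x + B z y"
  by (metis form_add_left form_sym m_closed)

lemma form_nat_pow:
  "\<lbrakk>x \<in> carrier L; y \<in> carrier L\<rbrakk> \<Longrightarrow> B (x [^] (k::nat)) y = of_nat k * B x y"
  by (induction k) (simp_all add: form_one form_add_left algebra_simps)

lemma form_int_pow:
  "\<lbrakk>x \<in> carrier L; y \<in> carrier L\<rbrakk> \<Longrightarrow> B (x [^] (k::int)) y = of_int k * B x y"
  by (cases k rule: int_cases2) (simp_all add: int_pow_int int_pow_neg_int form_inv form_nat_pow)

lemma form_int_pow_right:
  "\<lbrakk>x \<in> carrier L; y \<in> carrier L\<rbrakk> \<Longrightarrow> B y (x [^] (k::int)) = of_int k * B y x"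
  by (metis form_int_pow form_sym int_pow_closed)

lemma form_combination:
  fixes k m :: int
  assumes x: "x \<in> carrier L" and y: "y \<in> carrier L"
  shows "B (x [^] k \<otimes> y [^] m) (x [^] k \<otimes> y [^] m)
         = of_int k^2 * B x x + 2 * of_int k * of_int m * B x y + of_int m^2 * B y y"
  using x y form_sym[OF x y]
  by (simp add: form_add_left form_add_right form_int_pow form_int_pow_right power2_eq_square algebra_simps)

text \<open>
  If \<open>B x y \<noteq> 0\<close>, then \<open>B (k x + y) (k x + y) = 2 k B x y + B y y\<close> is negative for a suitable integer
  \<open>k\<close>.
\<close>

lemma isotropic_in_radical:
  assumes x: "x \<in> carrier L" and 0: "B x x = 0"
  shows "x \<in> radical L B"
proof -
  have "B x y = 0" if y: "y \<in> carrier L" for y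
  proof (rule ccontr)
    assume "B x y \<noteq> 0"
    then obtain n :: nat where n: "B y y < of_nat n * (2 * \<bar>B x y\<bar>)"
      using ex_less_of_nat_mult[of "2 * \<bar>B x y\<bar>"] by auto
    define k :: int where "k = (if B x y < 0 then int n else - int n)"
    have "0 \<le> B (x [^] k \<otimes> y [^] (1::int)) (x [^] k \<otimes> y [^] (1::int))"
      using x y by (intro form_nonneg) simp
    also have "\<dots> = 2 * of_int k * B x y + B y y"
      by (subst form_combination) (simp_all add: x y 0)
    also have "\<dots> < 0" using n by (auto simp: k_def split: if_splits)
    finally show False by simp
  qed
  then show ?thesis using x by (simp add: radical_def)
qed

text \<open>
  The two pairings \<open>m\<close> and \<open>k\<close> of \<open>a\<close> and \<open>b\<close> are integers, and they are both zero or their product is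
  positive. Since \<open>2 a - m b\<close> has nonnegative square length, the product is at most 4.
\<close>

lemma pairing_bounded:
  assumes a: "a \<in> R" and b: "b \<in> R"
  shows "\<bar>pairing B a b\<bar> \<le> 4"
proof -
  obtain m k :: int where m: "pairing B a b = of_int m" and k: "pairing B b a = of_int k"
    using roots_integral[OF a b] roots_integral[OF b a] by (auto elim!: Ints_cases)
  have pos: "0 < B a a" "0 < B b b" using a b root_norm_pos by auto
  have ab: "2 * B a b = of_int m * B b b" "2 * B a b = of_int k * B a a"
    using m k pos form_sym[of a b] a b root_closed by (auto simp: pairing_def field_simps)
  have "0 \<le> B (a [^] (2::int) \<otimes> b [^] (- m)) (a [^] (2::int) \<otimes> b [^] (- m))"
    using a b root_closed by (intro form_nonneg) simp
  also have "\<dots> = 4 * B a a - 2 * of_int m * (2 * B a b) + of_int m^2 * B b b"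
    using a b root_closed by (subst form_combination) simp_all
  also have "\<dots> = 4 * B a a - of_int m * (of_int m * B b b)"
    by (simp only: ab(1)) (simp add: power2_eq_square algebra_simps)
  also have "of_int m * B b b = of_int k * B a a" using ab by simp
  finally have "of_int (m * k) * B a a \<le> 4 * B a a" by (simp add: algebra_simps)
  then have le: "m * k \<le> 4" using pos(1) by (simp add: mult_le_cancel_right flip: of_int_mult)
  have "\<bar>m\<bar> \<le> 4"
  proof (cases "m = 0")
    case False
    have eq: "of_int k * B a a = of_int m * B b b" using ab by simp
    have "0 < of_int m * (of_int m * B b b)" using False pos by (auto simp: zero_less_mult_iff mult_less_0_iff)
    also have "\<dots> = of_int (m * k) * B a a" by (simp add: eq[symmetric])
    finally have "0 < m * k" using pos by (simp add: zero_less_mult_iff)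
    then have "1 \<le> \<bar>k\<bar>" by (cases "k = 0") auto
    then have "\<bar>m\<bar> * 1 \<le> \<bar>m\<bar> * \<bar>k\<bar>" by (intro mult_left_mono) auto
    also have "\<dots> = m * k" using \<open>0 < m * k\<close> by (metis abs_mult abs_of_pos)
    finally show ?thesis using le by simp
  qed simp
  then have "rat_of_int \<bar>m\<bar> \<le> 4" by (metis of_int_le_iff of_int_numeral)
  then show ?thesis by (simp add: m)
qed

lemma subgroup_radical: "subgroup (radical L B) L"
  by (rule subgroupI) (auto simp: radical_def form_inv form_add_left form_one intro!: exI[of _ \<one>])

lemma normal_radical: "radical L B \<lhd> L"
  using subgroup_radical by (rule subgroup_imp_normal)

abbreviation proj :: "'a \<Rightarrow> 'a set" where
  "proj x \<equiv> radical L B #> x"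

abbreviation quot :: "'a set monoid" where
  "quot \<equiv> L Mod radical L B"

sublocale proj: group_hom L quot proj
  using normal.r_coset_hom_Mod[OF normal_radical] normal.factorgroup_is_group[OF normal_radical]
  by (simp add: group_hom_def group_hom_axioms_def is_group)

lemma proj_eqI:
  assumes x: "x \<in> carrier L" and y: "y \<in> carrier L" and eq: "\<And>z. z \<in> carrier L \<Longrightarrow> B x z = B y z"
  shows "proj x = proj y"
proof -
  have "x \<otimes> inv y \<in> radical L B"
    using x y eq by (simp add: radical_def form_add_left form_inv)
  moreover have "x = (x \<otimes> inv y) \<otimes> y" using x y by (simp add: m_assoc)
  ultimately have "x \<in> proj y" unfolding r_coset_def by blast
  then show ?thesis using repr_independence[OF _ y subgroup_radical] by simp
qed

lemma form_eq_on_generators: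
  assumes S: "S \<subseteq> carrier L" "generate L S = carrier L" and x: "x \<in> carrier L" and y: "y \<in> carrier L"
    and eq: "\<And>b. b \<in> S \<Longrightarrow> B x b = B y b" and z: "z \<in> carrier L"
  shows "B x z = B y z"
proof -
  have "B z x = B z y" if "z \<in> generate L S" for z
    using that
  proof induction
    case one
    then show ?case using x y form_one by simp
  next
    case (incl h)
    then show ?case using x y S eq[OF incl] form_sym[of h x] form_sym[of h y] by auto
  next
    case (inv h)
    then have "h \<in> carrier L" using S by auto
    then show ?case using x y eq[OF inv] form_sym[of h x] form_sym[of h y] by (simp add: form_inv)
  next
    case (eng h1 h2)
    then show ?case using x y S(2) by (simp add: form_add_left)
  qed
  then show ?thesis using z S(2) x y form_sym by metis
qed

text \<open>
  Modulo the radical, a root is determined by its pairings with the elements of a generating set.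
  If this set is finite and consists of roots, the boundedness of pairings between roots leaves only
  finitely many possibilities.
\<close>

lemma finite_quot_roots:
  assumes S: "finite S" "S \<subseteq> R" "generate L S = carrier L"
  shows "finite (quot_roots L B R)"
proof -
  define key where "key a = restrict (\<lambda>b. pairing B a b) S" for a
  have "key a \<in> S \<rightarrow>\<^sub>E of_int ` {-4..4}" if a: "a \<in> R" for a
  proof -
    have "pairing B a b \<in> of_int ` {-4..4}" if b: "b \<in> S" for b
    proof -
      have "pairing B a b \<in> \<int>" using roots_integral a b S(2) by blast
      then obtain m where m: "pairing B a b = of_int m" by (rule Ints_cases)
      have "\<bar>pairing B a b\<bar> \<le> 4" using pairing_bounded a b S(2) by auto
      then have "m \<in> {-4..4}" by (simp add: m abs_le_iff flip: of_int_abs)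
      then show ?thesis using m by auto
    qed
    then show ?thesis by (auto simp: key_def)
  qed
  then have fin: "finite (key ` R)"
    by (intro finite_subset[OF _ finite_PiE[of S "\<lambda>_. of_int ` {-4..4}"]]) (auto simp: S(1))
  have key_proj: "proj a = proj a'" if a: "a \<in> R" "a' \<in> R" and eq: "key a = key a'" for a a'
  proof (rule proj_eqI)
    fix z assume z: "z \<in> carrier L"
    show "B a z = B a' z"
    proof (rule form_eq_on_generators[OF _ S(3) _ _ _ z])
      fix b assume b: "b \<in> S"
      then have "pairing B a b = pairing B a' b"
        using eq unfolding key_def by (metis restrict_apply')
      moreover have "0 < B b b" using b S(2) root_norm_pos by auto
      ultimately show "B a b = B a' b" by (simp add: pairing_def)
    qed (use a S(2) root_closed in auto)
  qed (use a root_closed in auto)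
  define g where "g k = (SOME a. a \<in> R \<and> key a = k)" for k
  have "proj a = proj (g (key a))" if a: "a \<in> R" for a
    using someI[of "\<lambda>a'. a' \<in> R \<and> key a' = key a" a] key_proj[OF a, of "g (key a)"] a
    by (simp add: g_def)
  then have "quot_roots L B R = (\<lambda>k. proj (g k)) ` key ` R"
    unfolding quot_roots_def image_image by (rule image_cong[OF HOL.refl])
  then show ?thesis using fin by simp
qed

lemma carrier_quot: "carrier quot = proj ` carrier L"
  by (rule carrier_FactGroup)

lemma pairing_proj:
  "\<lbrakk>x \<in> carrier L; a \<in> carrier L\<rbrakk> \<Longrightarrow> pairing (quot_form B) (proj x) (proj a) = pairing B x a"
  by (simp add: pairing_def quot_form_rcoset)

lemma reflection_closed: "\<lbrakk>a \<in> R; x \<in> carrier L\<rbrakk> \<Longrightarrow> reflection L B a x \<in> carrier L"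
  by (simp add: reflection_def root_closed)

lemma reflection_proj:
  assumes "a \<in> R" and "x \<in> carrier L"
  shows "reflection quot (quot_form B) (proj a) (proj x) = proj (reflection L B a x)"
proof -
  have "a \<in> carrier L" using assms root_closed by simp
  then show ?thesis using assms(2)
    by (simp add: reflection_def pairing_proj proj.hom_int_pow proj.hom_mult proj.hom_inv
        del: mult_FactGroup)
qed

lemma finite_root_lattice_quot:
  assumes fin: "finite (quot_roots L B R)"
  shows "finite_root_lattice quot (quot_form B) (quot_roots L B R)"
proof -
  interpret Q: comm_group quot using subgroup_radical by (rule abelian_FactGroup)
  show ?thesis
  proof
    fix X Y Z assume "X \<in> carrier quot" "Y \<in> carrier quot" "Z \<in> carrier quot"
    then obtain x y z where "X = proj x" "Y = proj y" "Z = proj z"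
      "x \<in> carrier L" "y \<in> carrier L" "z \<in> carrier L" by (auto simp: carrier_quot)
    then show "quot_form B (X \<otimes>\<^bsub>quot\<^esub> Y) Z = quot_form B X Z + quot_form B Y Z"
      by (simp add: quot_form_rcoset form_add_left del: mult_FactGroup flip: proj.hom_mult)
  next
    fix X Y assume "X \<in> carrier quot" "Y \<in> carrier quot"
    then show "quot_form B X Y = quot_form B Y X"
      by (auto simp: carrier_quot quot_form_rcoset form_sym)
  next
    fix X assume X: "X \<in> carrier quot" "X \<noteq> \<one>\<^bsub>quot\<^esub>"
    then obtain x where x: "X = proj x" "x \<in> carrier L" by (auto simp: carrier_quot)
    have "B x x \<noteq> 0"
      using isotropic_in_radical[OF x(2)] coset_join2[OF x(2) subgroup_radical] X x by auto
    then show "0 < quot_form B X X" using form_nonneg[OF x(2)] x by (simp add: quot_form_rcoset)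
  next
    show "quot_roots L B R \<subseteq> carrier quot - {\<one>\<^bsub>quot\<^esub>}"
    proof
      fix X assume "X \<in> quot_roots L B R"
      then obtain a where a: "X = proj a" "a \<in> R" by (auto simp: quot_roots_def)
      have "a \<notin> radical L B"
        using root_norm_pos[OF a(2)] root_closed[OF a(2)] by (force simp: radical_def)
      then have "proj a \<noteq> radical L B"
        using coset_join1[OF _ root_closed[OF a(2)] subgroup_radical] by blast
      then show "X \<in> carrier quot - {\<one>\<^bsub>quot\<^esub>}"
        using a root_closed by (auto simp: carrier_quot)
    qed
  next
    have "R \<subseteq> carrier L" using roots_subset by auto
    from proj.generate_img[OF this]
    show "generate quot (quot_roots L B R) = carrier quot"
      by (simp add: quot_roots_def roots_generate carrier_quot)
  next
    fix X Y assume "X \<in> quot_roots L B R" "Y \<in> quot_roots L B R"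
    then obtain a b where ab: "X = proj a" "Y = proj b" "a \<in> R" "b \<in> R" by (auto simp: quot_roots_def)
    then have "reflection L B a b \<in> R" using roots_reflection by blast
    then show "reflection quot (quot_form B) X Y \<in> quot_roots L B R"
      using ab root_closed by (simp add: reflection_proj quot_roots_def)
  next
    fix X Y assume "X \<in> quot_roots L B R" "Y \<in> carrier quot"
    then show "pairing (quot_form B) Y X \<in> \<int>"
      using pairing_Ints root_closed by (auto simp: quot_roots_def carrier_quot pairing_proj)
  qed (fact fin)
qed

lemma refl_product_proj:
  assumes "set as \<subseteq> R" and x: "x \<in> carrier L"
  shows "refl_product L B as x \<in> carrier L \<and>
    refl_product quot (quot_form B) (map proj as) (proj x) = proj (refl_product L B as x)"
  using assms(1)
proof (induction as)
  case Nil
  then show ?case using x by (simp add: refl_product_Nil)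
next
  case (Cons a as)
  then show ?case using x by (simp add: refl_product_Cons reflection_closed reflection_proj)
qed

text \<open>
  For this reason the Weyl group maps cosets of the radical onto cosets.
\<close>

lemma refl_product_radical_mult:
  assumes "set as \<subseteq> R" and x: "x \<in> carrier L" and t: "t \<in> radical L B"
  shows "refl_product L B as (t \<otimes> x) = t \<otimes> refl_product L B as x"
  using assms(1)
proof (induction as)
  case Nil
  then show ?case using x t by (simp add: refl_product_Nil radical_def)
next
  case (Cons a as)
  define y where "y = refl_product L B as x"
  have tL: "t \<in> carrier L" using t by (simp add: radical_def)
  have y: "y \<in> carrier L" using refl_product_proj[OF _ x, of as] Cons.prems by (simp add: y_def)
  have a: "a \<in> carrier L" using Cons.prems root_closed by auto
  have "B (t \<otimes> y) a = B y a" using t tL y a by (simp add: form_add_left radical_def)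
  then have "pairing B (t \<otimes> y) a = pairing B y a" by (simp add: pairing_def)
  then have "reflection L B a (t \<otimes> y) = t \<otimes> reflection L B a y"
    using tL y a by (simp add: reflection_def m_assoc)
  then show ?case using Cons x tL by (simp add: refl_product_Cons y_def)
qed

lemma induced_map_refl_product:
  assumes as: "set as \<subseteq> R"
  shows "induced_map L B (refl_product L B as) = refl_product quot (quot_form B) (map proj as)"
proof (rule extensionalityI)
  show "induced_map L B (refl_product L B as) \<in> extensional (carrier quot)"
    by (simp add: induced_map_def)
  show "refl_product quot (quot_form B) (map proj as) \<in> extensional (carrier quot)"
    by (rule refl_product_extensional)
  fix X assume X: "X \<in> carrier quot"
  then obtain x where x: "X = proj x" "x \<in> carrier L" by (auto simp: carrier_quot)
  have "refl_product L B as ` proj x = proj (refl_product L B as x)"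
  proof -
    have "proj y = (\<lambda>t. t \<otimes> y) ` radical L B" for y by (auto simp: r_coset_def)
    then show ?thesis
      by (simp add: image_image refl_product_radical_mult[OF as x(2)] cong: image_cong)
  qed
  then show "induced_map L B (refl_product L B as) X
      = refl_product quot (quot_form B) (map proj as) X"
    using X x refl_product_proj[OF as x(2)] by (simp add: induced_map_def)
qed

lemma form_finprod:
  assumes "finite I" and "\<And>i. i \<in> I \<Longrightarrow> g i \<in> carrier L" and y: "y \<in> carrier L"
  shows "B (finprod L g I) y = (\<Sum>i\<in>I. B (g i) y)"
  using assms(1,2)
proof (induction I)
  case empty
  then show ?case using form_one[OF y] by simp
next
  case (insert i I)
  then show ?case using y by (subst finprod_insert) (auto simp: form_add_left)
qed

text \<open>
  A family that is a basis of the radical is independent in \<open>L\<close> as well, because products of powers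
  mean the same in both groups.
\<close>

lemma radical_basis:
  assumes "has_rank (L\<lparr>carrier := radical L B\<rparr>) r"
  obtains e where "\<And>k. k < r \<Longrightarrow> e k \<in> radical L B" "int_independent L {..<r} e"
proof -
  let ?F = "free_Abelian_group {..<r}" and ?K = "L\<lparr>carrier := radical L B\<rparr>"
  have K: "group ?K" using subgroup.subgroup_is_group[OF subgroup_radical is_group] .
  obtain f where f: "f \<in> iso ?F ?K"
    using assms group.iso_sym[OF K] unfolding has_rank_def is_iso_def by blast
  have rad: "f x \<in> radical L B" if "Poly_Mapping.keys x \<subseteq> {..<r}" for x
    using f that by (auto simp: iso_def hom_def)
  interpret f: group_hom ?F L f
    using f subgroup.subset[OF subgroup_radical]
    by (auto simp: group_hom_def group_hom_axioms_def is_group iso_def hom_def)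
  have inj: "inj_on f (carrier ?F)" using f by (simp add: iso_iff)
  define e where "e k = f (frag_of k)" for k
  have e: "e k \<in> radical L B" if "k < r" for k using that rad by (simp add: e_def)
  have eL: "e k \<in> carrier L" if "k < r" for k using e[OF that] by (simp add: radical_def)
  have keys: "Poly_Mapping.keys (\<Sum>k\<in>J. frag_cmul (c k) (frag_of k)) \<subseteq> {..<r}" if "J \<subseteq> {..<r}" for J and c :: "nat \<Rightarrow> int"
    using sum_closed_free_Abelian_group[of J "\<lambda>k. frag_cmul (c k) (frag_of k)" "{..<r}"] that
    by (auto simp: keys_cmul_iff subset_iff)
  have prod: "f (\<Sum>k\<in>J. frag_cmul (c k) (frag_of k)) = finprod L (\<lambda>k. e k [^] c k) J"
    if "J \<subseteq> {..<r}" for J and c :: "nat \<Rightarrow> int"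
    using finite_subset[OF that finite_lessThan] that
  proof (induction J)
    case empty
    then show ?case using f.hom_one by simp
  next
    case (insert k J)
    have k: "k < r" using insert.prems by simp
    have "f (frag_cmul (c k) (frag_of k)) = e k [^] c k"
      using f.hom_int_pow[of "frag_of k" "c k"] k by (simp add: e_def)
    moreover have "f (frag_cmul (c k) (frag_of k) + (\<Sum>k\<in>J. frag_cmul (c k) (frag_of k)))
        = f (frag_cmul (c k) (frag_of k)) \<otimes> f (\<Sum>k\<in>J. frag_cmul (c k) (frag_of k))"
      using f.hom_mult[of "frag_cmul (c k) (frag_of k)" "\<Sum>k\<in>J. frag_cmul (c k) (frag_of k)"]
        keys[of J c] keys[of "{k}" c] k insert.prems by simp
    ultimately show ?case using insert eL by (subst finprod_insert) auto
  qed
  have "c k = 0" if "finprod L (\<lambda>k. e k [^] c k) {..<r} = \<one>" "k < r" for k and c :: "nat \<Rightarrow> int"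
  proof -
    have "f (\<Sum>k<r. frag_cmul (c k) (frag_of k)) = f 0"
      using prod[of "{..<r}" c] that(1) f.hom_one by simp
    then have "(\<Sum>k<r. frag_cmul (c k) (frag_of k)) = 0"
      using keys[of "{..<r}" c] by (intro inj_onD[OF inj]) auto
    then have "0 = Poly_Mapping.lookup (\<Sum>k<r. frag_cmul (c k) (frag_of k)) k" by simp
    also have "\<dots> = (\<Sum>j<r. if j = k then c j else 0)"
      unfolding lookup_sum by (intro sum.cong) (auto simp: lookup_single)
    finally show ?thesis using that(2) by simp
  qed
  then have "int_independent L {..<r} e" by (auto simp: int_independent_def)
  then show ?thesis using that e by blast
qed

text \<open>
  Choose representatives in \<open>L\<close> of the members of \<open>A\<close> and add a basis of the radical. Pairing an
  integral relation between all these with an arbitrary element of \<open>L\<close> eliminates the radical,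
  so the coefficients of the representatives vanish; what remains is a relation in the radical.
\<close>

lemma independent_functionals_card:
  assumes rad: "has_rank (L\<lparr>carrier := radical L B\<rparr>) r"
    and A: "finite A" "A \<subseteq> carrier quot"
    and indep: "\<And>c. \<forall>Y\<in>carrier quot. (\<Sum>X\<in>A. c X * quot_form B X Y) = 0 \<Longrightarrow> \<forall>X\<in>A. c X = 0"
  shows "card A + r \<le> n"
proof -
  obtain e where e: "\<And>k. k < r \<Longrightarrow> e k \<in> radical L B" and e_indep: "int_independent L {..<r} e"
    using radical_basis[OF rad] by blast
  have eL: "e k \<in> carrier L" if "k < r" for k using e[OF that] by (simp add: radical_def)
  define rep where "rep = inv_into (carrier L) proj"
  have rep: "rep X \<in> carrier L" "proj (rep X) = X" if "X \<in> A" for X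
    using that A(2) inv_into_into[of X proj "carrier L"] f_inv_into_f[of X proj "carrier L"]
    unfolding rep_def carrier_quot by blast+
  define u where "u = case_sum rep e"
  have uL: "u i \<in> carrier L" if "i \<in> A <+> {..<r}" for i
    using that rep eL by (auto simp: u_def)
  have "int_independent L (A <+> {..<r}) u"
    unfolding int_independent_def
  proof (intro allI impI)
    fix c :: "'a set + nat \<Rightarrow> int"
    assume one: "finprod L (\<lambda>i. u i [^] c i) (A <+> {..<r}) = \<one>"
    have "(\<Sum>X\<in>A. of_int (c (Inl X)) * quot_form B X Y) = 0" if Y: "Y \<in> carrier quot" for Y
    proof -
      obtain y where y: "Y = proj y" "y \<in> carrier L" using Y by (auto simp: carrier_quot)
      have "0 = B (finprod L (\<lambda>i. u i [^] c i) (A <+> {..<r})) y"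
        using one form_one[OF y(2)] by simp
      also have "\<dots> = (\<Sum>i\<in>A <+> {..<r}. of_int (c i) * B (u i) y)"
        using A(1) uL y(2) by (subst form_finprod) (auto simp: form_int_pow intro!: sum.cong)
      also have "\<dots> = (\<Sum>X\<in>A. of_int (c (Inl X)) * B (rep X) y)
          + (\<Sum>k<r. of_int (c (Inr k)) * B (e k) y)"
        using A(1) by (simp add: sum.Plus u_def)
      also have "(\<Sum>k<r. of_int (c (Inr k)) * B (e k) y) = 0"
        using e y(2) by (simp add: radical_def)
      also have "(\<Sum>X\<in>A. of_int (c (Inl X)) * B (rep X) y)
          = (\<Sum>X\<in>A. of_int (c (Inl X)) * quot_form B X Y)"
        using rep quot_form_rcoset[OF _ y(2)] y(1) by (intro sum.cong) (metis, metis)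
      finally show ?thesis by simp
    qed
    then have cl: "c (Inl X) = 0" if "X \<in> A" for X
      using indep[of "\<lambda>X. of_int (c (Inl X))"] that by simp
    have "finprod L (\<lambda>i. u i [^] c i) (A <+> {..<r}) = finprod L (\<lambda>i. u i [^] c i) (Inr ` {..<r})"
      using cl uL A(1) by (intro finprod_mono_neutral_cong_left[symmetric]) auto
    also have "\<dots> = finprod L (\<lambda>k. e k [^] c (Inr k)) {..<r}"
      using eL by (subst finprod_reindex) (auto simp: u_def)
    finally have "\<forall>k\<in>{..<r}. c (Inr k) = 0"
      using e_indep one unfolding int_independent_def by metis
    then show "\<forall>i\<in>A <+> {..<r}. c i = 0" using cl by auto
  qed
  from int_independent_card_le_rank[OF free _ uL this] show ?thesis
    using A(1) by (simp add: card_Plus)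
qed

end

section \<open>Lengths of the induced element\<close>

theorem lemma7p4:
  fixes L :: "('a, 'b) monoid_scheme"
    and n r :: nat
    and B :: "'a \<Rightarrow> 'a \<Rightarrow> rat"
    and R :: "'a set"
    and w :: "'a \<Rightarrow> 'a"
  assumes "extended_affine_root_lattice L n B R"
    and "has_rank (L\<lparr>carrier := radical L B\<rparr>) r" and "r \<ge> 1"
    and "quasi_coxeter L n B R w"
  shows "weyl_length (L Mod radical L B) (quot_form B) (quot_roots L B R) (induced_map L B w)
           \<le> n - r
       \<and> weyl_length (L Mod radical L B) (quot_form B) (quot_roots L B R) (induced_map L B w)
           + 2 * k5 (L Mod radical L B) (quot_form B) (quot_roots L B R) (induced_map L B w)
           \<le> n"
proof -
  interpret extended_affine_root_lattice L n B R by fact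
  let ?R = "quot_roots L B R" and ?B = "quot_form B" and ?w = "induced_map L B w"
  let ?l = "weyl_length quot ?B ?R ?w"
  obtain as where as: "set as \<subseteq> R" "w = refl_product L B as" "length as = n"
    and gen: "generate L (set as) = carrier L"
    using assms(4) by (auto simp: quasi_coxeter_def is_presentation_iff subroot_lattice_def)
  interpret Q: finite_root_lattice quot ?B ?R
    using finite_root_lattice_quot[OF finite_quot_roots[OF _ as(1) gen]] by simp
  let ?as = "map proj as"
  have pres: "is_presentation quot ?B ?R ?w ?as"
    using as by (auto simp: is_presentation_iff induced_map_refl_product quot_roots_def)
  have full: "subroot_lattice quot ?as = carrier quot"
    using proj.generate_img[of "set as"] as(1) gen root_closed
    by (auto simp: subroot_lattice_def carrier_quot)
  have l_le: "?l \<le> length bs" if "is_presentation quot ?B ?R ?w bs" for bs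
    unfolding weyl_length_def using that by (intro Least_le) auto
  obtain A bs where A: "finite A" "A \<subseteq> ?R"
    "\<And>c. \<forall>Y\<in>carrier quot. (\<Sum>X\<in>A. c X * ?B X Y) = 0 \<Longrightarrow> \<forall>X\<in>A. c X = 0"
    and bs: "is_presentation quot ?B ?R ?w bs" "length bs \<le> card A"
    using Q.short_presentation[OF pres] by blast
  have "card A + r \<le> n"
    using A Q.root_closed by (intro independent_functionals_card[OF assms(2)]) auto
  then have first: "?l \<le> n - r" using l_le[OF bs(1)] bs(2) by simp
  have "\<exists>ds. is_presentation quot ?B ?R ?w ds \<and> length ds = ?l"
    unfolding weyl_length_def
    by (rule LeastI_ex[where P = "\<lambda>k. \<exists>ds. is_presentation quot ?B ?R ?w ds \<and> length ds = k"])
       (use pres in blast)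
  then obtain ds where ds: "is_presentation quot ?B ?R ?w ds" "length ds = ?l" by blast
  have "even (length ?as + length ds)" using pres ds(1) by (rule Q.presentation_parity)
  then have "even (n + ?l)" using as(3) ds(2) by simp
  moreover have l_le_n: "?l \<le> n" using l_le[OF pres] as(3) by simp
  ultimately have "even (n - ?l)" by simp
  then obtain k where "n - ?l = 2 * k" by (rule evenE)
  then have k: "n = ?l + 2 * k" using l_le_n by simp
  have "k5 quot ?B ?R ?w \<le> k"
    unfolding k5_def by (rule Least_le, rule exI[of _ ?as]) (use pres full k as(3) in simp)
  then show ?thesis using first k by simp
qed

end
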